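(* Let $\mathbf F=(0,f)$ with $f\in L^2((0,T)\times\omega)$, and assume that the controlled wave problem $$\Phi'+A\Phi+\mathbf F\,\mathbf 1_\omega+G(\Phi)=0\ \text{ on }(0,T),\qquad \Phi(0,\cdot)=\Phi_0,\quad \Phi(T,\cdot)=\Phi_T$$ possesses the control $\mathbf F\mathbf 1_\omega=(0,f\mathbf 1_\omega)$ (i.e. for this $f$ the problem has a solution reaching $\Phi_T$ at time $T$). Let $\epsilon>0$, and let $\sigma\in C^2(\mathbb R)$ be an activation function that is not a polynomial. Then there exist a spectral truncation order $P_c\in\mathbb N^*$, a width $m_c\in\mathbb N^*$ and parameters $\theta_c=(A_j,W_j,B_j)_{j=1}^{P_c}$, with $A_j,W_j,B_j\in\mathbb R^{m_c}$, such that the function $$\widetilde{\mathbf F}_{\theta_c}\mathbf 1_\omega=\bigl(0,\widetilde f_{\theta_c}\mathbf 1_\omega\bigr),\qquad \widetilde f_{\theta_c}(t,x)=\sum_{j=1}^{P_c}A_j\cdot\sigma(W_jt+B_j)\,e_j(x),$$ satisfies $$\bigl\|\widetilde{\mathbf F}_{\theta_c}\mathbf 1_\omega-\mathbf F\mathbf 1_\omega\bigr\|_{L^2((0,T);\mathcal E)}<\epsilon .$$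
   Context: $\Omega=(0,1)^N$, $\omega\subset\Omega$ is a nonempty open subset with characteristic function $\mathbf 1_\omega$, $T>0$, $\alpha\ge 0$ is a real constant, $\mathbb N^*=\{1,2,\dots\}$. States and controls are real-valued. The energy space is $\mathcal E=H_0^1(\Omega)\times L^2(\Omega)$ with norm $\|(u,z)\|_{\mathcal E}^2=\int_\Omega(|\nabla u|^2+\alpha|u|^2)\,dx+\int_\Omega|z|^2\,dx$. The operator $A$ has domain $D(A)=(H^2(\Omega)\cap H^1_0(\Omega))\times H_0^1(\Omega)$ and $A(u,z)=(-z,\,-\Delta u+\alpha u)$. $G(\Phi)=(0,g(u))$ for $\Phi=(u,z)$, where $g:\mathbb R\to\mathbb R$ is a nonlinearity, identified with the Nemytskii operator $u\mapsto g(u)$ from $H_0^1(\Omega)$ to $L^2(\Omega)$. $\Phi_0,\Phi_T\in\mathcal E$ are the prescribed initial and target states. (The problem is the first-order form of $u_{tt}-\Delta u+g(u)+\alpha u+f\mathbf 1_\omega=0$ with homogeneous Dirichlet boundary conditions, $\Phi=(u,u_t)$.) Standing assumption: $(\omega,T)$ satisfies the Geometric Control Condition, i.e. every optical ray propagating in $\Omega$ and reflecting on $\partial\Omega$ enters $\omega$ within the time interval $(0,T)$. For $k\in(\mathbb N^* )^N$ the Dirichlet eigenfunctions of $-\Delta$ are $e_k(x)=2^{N/2}\prod_{j=1}^N\sin(k_j\pi x_j)$, with eigenvalues $\mu_k=\pi^2\sum_j k_j^2$; they are enumerated as $e_j,\mu_j$, $j\in\mathbb N^*$, by ordering the multi-indices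 by increasing $\sum_j k_j^2$, ties being broken lexicographically. The function $\sigma$ acts componentwise on vectors, "$\cdot$" is the Euclidean inner product on $\mathbb R^{m_c}$, and for $B\in\mathbb R^{m_c}$, $W\in\mathbb R^{m_c}$, $t\in\mathbb R$, $Wt+B\in\mathbb R^{m_c}$. *)

theory Defs
  imports
    "HOL-Analysis.Analysis"
    "HOL-Computational_Algebra.Polynomial"
    "HOL-Library.Function_Algebras"
begin

text \<open>
  Elements of function spaces over an open set are represented by functions on the whole type;
  only their values on the set matter, and equality is equality almost everywhere on it.
  Sums and differences of functions are those of \<^theory>\<open>HOL-Library.Function_Algebras\<close>.
\<close>

definition unit_cube :: "(real ^ 'n::finite) set" where
  "unit_cube = {x. \<forall>i. 0 < x $ i \<and> x $ i < 1}"

section \<open>Sobolev spaces\<close>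

definition L2_space :: "'a::euclidean_space set \<Rightarrow> ('a \<Rightarrow> real) set" where
  "L2_space S = {h. h \<in> borel_measurable (lebesgue_on S) \<and> integrable (lebesgue_on S) (\<lambda>x. (h x)\<^sup>2)}"

definition L2_norm :: "'a::euclidean_space set \<Rightarrow> ('a \<Rightarrow> real) \<Rightarrow> real" where
  "L2_norm S h = sqrt (integral\<^sup>L (lebesgue_on S) (\<lambda>x. (h x)\<^sup>2))"

primrec C_k :: "nat \<Rightarrow> ('a::euclidean_space \<Rightarrow> real) \<Rightarrow> bool" where
  "C_k 0 h \<longleftrightarrow> continuous_on UNIV h"
| "C_k (Suc k) h \<longleftrightarrow>
     h differentiable_on UNIV \<and> (\<forall>b\<in>Basis. C_k k (\<lambda>x. frechet_derivative h (at x) b))"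

definition test_functions :: "'a::euclidean_space set \<Rightarrow> ('a \<Rightarrow> real) set" where
  "test_functions S =
     {\<phi>. (\<forall>k. C_k k \<phi>) \<and> (\<exists>K. compact K \<and> K \<subseteq> S \<and> (\<forall>x. x \<notin> K \<longrightarrow> \<phi> x = 0))}"

definition is_weak_partial ::
  "(real ^ 'n::finite) set \<Rightarrow> 'n \<Rightarrow> (real ^ 'n \<Rightarrow> real) \<Rightarrow> (real ^ 'n \<Rightarrow> real) \<Rightarrow> bool" where
  "is_weak_partial S i u v \<longleftrightarrow>
     v \<in> L2_space S \<and>
     (\<forall>\<phi>\<in>test_functions S.
        integral\<^sup>L (lebesgue_on S) (\<lambda>x. u x * frechet_derivative \<phi> (at x) (axis i 1))
        = - integral\<^sup>L (lebesgue_on S) (\<lambda>x. v x * \<phi> x))"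

text \<open>Weak derivatives are unique up to null sets, so the choice below is immaterial.\<close>

definition weak_partial ::
  "(real ^ 'n::finite) set \<Rightarrow> 'n \<Rightarrow> (real ^ 'n \<Rightarrow> real) \<Rightarrow> real ^ 'n \<Rightarrow> real" where
  "weak_partial S i u = (SOME v. is_weak_partial S i u v)"

definition weak_grad ::
  "(real ^ 'n::finite) set \<Rightarrow> (real ^ 'n \<Rightarrow> real) \<Rightarrow> real ^ 'n \<Rightarrow> real ^ 'n" where
  "weak_grad S u x = (\<chi> i. weak_partial S i u x)"

definition weak_laplacian ::
  "(real ^ 'n::finite) set \<Rightarrow> (real ^ 'n \<Rightarrow> real) \<Rightarrow> real ^ 'n \<Rightarrow> real" where
  "weak_laplacian S u x = (\<Sum>i\<in>UNIV. weak_partial S i (weak_partial S i u) x)"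

definition H1 :: "(real ^ 'n::finite) set \<Rightarrow> (real ^ 'n \<Rightarrow> real) set" where
  "H1 S = {u \<in> L2_space S. \<forall>i. \<exists>v. is_weak_partial S i u v}"

definition H1_norm :: "(real ^ 'n::finite) set \<Rightarrow> (real ^ 'n \<Rightarrow> real) \<Rightarrow> real" where
  "H1_norm S u =
     sqrt ((L2_norm S u)\<^sup>2 + integral\<^sup>L (lebesgue_on S) (\<lambda>x. (norm (weak_grad S u x))\<^sup>2))"

definition H2 :: "(real ^ 'n::finite) set \<Rightarrow> (real ^ 'n \<Rightarrow> real) set" where
  "H2 S = {u \<in> H1 S. \<forall>i. weak_partial S i u \<in> H1 S}"

definition H1_0 :: "(real ^ 'n::finite) set \<Rightarrow> (real ^ 'n \<Rightarrow> real) set" where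
  "H1_0 S = {u \<in> H1 S. \<forall>\<epsilon>>0. \<exists>\<phi>\<in>test_functions S. H1_norm S (u - \<phi>) < \<epsilon>}"

section \<open>The energy space\<close>

type_synonym 'n state = "(real ^ 'n \<Rightarrow> real) \<times> (real ^ 'n \<Rightarrow> real)"

definition energy_space :: "'n::finite state set" where
  "energy_space = H1_0 unit_cube \<times> L2_space unit_cube"

definition energy_eq :: "'n::finite state \<Rightarrow> 'n state \<Rightarrow> bool" where
  "energy_eq \<Phi> \<Psi> \<longleftrightarrow>
     (AE x in lebesgue_on unit_cube. fst \<Phi> x = fst \<Psi> x \<and> snd \<Phi> x = snd \<Psi> x)"

definition energy_norm :: "real \<Rightarrow> 'n::finite state \<Rightarrow> real" where
  "energy_norm \<alpha> \<Phi> =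
     sqrt (integral\<^sup>L (lebesgue_on unit_cube)
             (\<lambda>x. (norm (weak_grad unit_cube (fst \<Phi>) x))\<^sup>2 + \<alpha> * (fst \<Phi> x)\<^sup>2)
           + integral\<^sup>L (lebesgue_on unit_cube) (\<lambda>x. (snd \<Phi> x)\<^sup>2))"

text \<open>The inner product inducing \<^const>\<open>energy_norm\<close>.\<close>

definition energy_inner :: "real \<Rightarrow> 'n::finite state \<Rightarrow> 'n state \<Rightarrow> real" where
  "energy_inner \<alpha> \<Phi> \<Psi> =
     integral\<^sup>L (lebesgue_on unit_cube)
       (\<lambda>x. weak_grad unit_cube (fst \<Phi>) x \<bullet> weak_grad unit_cube (fst \<Psi>) x
            + \<alpha> * (fst \<Phi> x * fst \<Psi> x))
     + integral\<^sup>L (lebesgue_on unit_cube) (\<lambda>x. snd \<Phi> x * snd \<Psi> x)"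

text \<open>
  The energy space is a separable Hilbert space, so by Pettis' theorem weak measurability is
  strong measurability. Consequently \<open>has_energy_integral\<close> below is the Bochner integral.
\<close>

definition energy_measurable :: "real \<Rightarrow> real set \<Rightarrow> (real \<Rightarrow> 'n::finite state) \<Rightarrow> bool" where
  "energy_measurable \<alpha> J \<Phi> \<longleftrightarrow>
     (AE t in lebesgue_on J. \<Phi> t \<in> energy_space) \<and>
     (\<forall>\<Psi>\<in>energy_space. (\<lambda>t. energy_inner \<alpha> (\<Phi> t) \<Psi>) \<in> borel_measurable (lebesgue_on J))"

definition has_energy_integral ::
  "real \<Rightarrow> (real \<Rightarrow> 'n::finite state) \<Rightarrow> 'n state \<Rightarrow> real set \<Rightarrow> bool" where
  "has_energy_integral \<alpha> \<Phi> I J \<longleftrightarrow>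
     energy_measurable \<alpha> J \<Phi> \<and>
     integrable (lebesgue_on J) (\<lambda>t. energy_norm \<alpha> (\<Phi> t)) \<and>
     I \<in> energy_space \<and>
     (\<forall>\<Psi>\<in>energy_space.
        integral\<^sup>L (lebesgue_on J) (\<lambda>t. energy_inner \<alpha> (\<Phi> t) \<Psi>) = energy_inner \<alpha> I \<Psi>)"

definition L2_energy :: "real \<Rightarrow> real set \<Rightarrow> (real \<Rightarrow> 'n::finite state) set" where
  "L2_energy \<alpha> J =
     {\<Phi>. energy_measurable \<alpha> J \<Phi> \<and>
         integrable (lebesgue_on J) (\<lambda>t. (energy_norm \<alpha> (\<Phi> t))\<^sup>2)}"

definition L2_energy_norm :: "real \<Rightarrow> real set \<Rightarrow> (real \<Rightarrow> 'n::finite state) \<Rightarrow> real" where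
  "L2_energy_norm \<alpha> J \<Phi> =
     sqrt (integral\<^sup>L (lebesgue_on J) (\<lambda>t. (energy_norm \<alpha> (\<Phi> t))\<^sup>2))"

section \<open>The controlled wave equation\<close>

definition wave_domain :: "'n::finite state set" where
  "wave_domain = (H2 unit_cube \<inter> H1_0 unit_cube) \<times> H1_0 unit_cube"

definition wave_op :: "real \<Rightarrow> 'n::finite state \<Rightarrow> 'n state" where
  "wave_op \<alpha> \<Phi> =
     (\<lambda>x. - snd \<Phi> x, \<lambda>x. - weak_laplacian unit_cube (fst \<Phi>) x + \<alpha> * fst \<Phi> x)"

definition nemytskii :: "(real \<Rightarrow> real) \<Rightarrow> 'n::finite state \<Rightarrow> 'n state" where
  "nemytskii g \<Phi> = (\<lambda>x. 0, \<lambda>x. g (fst \<Phi> x))"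

definition localized ::
  "(real ^ 'n::finite) set \<Rightarrow> (real \<times> (real ^ 'n) \<Rightarrow> real) \<Rightarrow> real \<Rightarrow> 'n state" where
  "localized \<omega> f t = (\<lambda>x. 0, \<lambda>x. f (t, x) * indicator \<omega> x)"

definition energy_continuous_on :: "real \<Rightarrow> real set \<Rightarrow> (real \<Rightarrow> 'n::finite state) \<Rightarrow> bool" where
  "energy_continuous_on \<alpha> J \<Phi> \<longleftrightarrow>
     (\<forall>t\<in>J. \<Phi> t \<in> energy_space) \<and>
     (\<forall>s\<in>J. ((\<lambda>t. energy_norm \<alpha> (\<Phi> t - \<Phi> s)) \<longlongrightarrow> 0) (at s within J))"

text \<open>
  Mild solutions of \<open>\<Phi>' + A \<Phi> + F + G \<Phi> = 0\<close> with \<open>\<Phi> 0 = \<Phi>0\<close>, in the time-integrated form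
  \<open>\<Phi> t = \<Phi>0 - A (\<integral>\<^sub>0\<^sup>t \<Phi>) - \<integral>\<^sub>0\<^sup>t (F + G \<Phi>)\<close>; for the generator \<open>-A\<close> of a \<open>C\<^sub>0\<close>-semigroup
  this is equivalent to Duhamel's formula.
\<close>

definition wave_solution ::
  "real \<Rightarrow> (real \<Rightarrow> real) \<Rightarrow> (real \<Rightarrow> 'n::finite state) \<Rightarrow> real \<Rightarrow> 'n state
     \<Rightarrow> (real \<Rightarrow> 'n state) \<Rightarrow> bool" where
  "wave_solution \<alpha> g F T \<Phi>0 \<Phi> \<longleftrightarrow>
     energy_continuous_on \<alpha> {0..T} \<Phi> \<and>
     energy_eq (\<Phi> 0) \<Phi>0 \<and>
     (\<forall>t\<in>{0..T}. \<exists>I\<in>wave_domain. \<exists>J.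
        has_energy_integral \<alpha> \<Phi> I {0..t} \<and>
        has_energy_integral \<alpha> (\<lambda>s. F s + nemytskii g (\<Phi> s)) J {0..t} \<and>
        energy_eq (\<Phi> t) (\<Phi>0 - wave_op \<alpha> I - J))"

definition steers ::
  "real \<Rightarrow> (real \<Rightarrow> real) \<Rightarrow> (real \<Rightarrow> 'n::finite state) \<Rightarrow> real \<Rightarrow> 'n state \<Rightarrow> 'n state \<Rightarrow> bool" where
  "steers \<alpha> g F T \<Phi>0 \<Phi>T \<longleftrightarrow>
     (\<exists>\<Phi>. wave_solution \<alpha> g F T \<Phi>0 \<Phi> \<and> energy_eq (\<Phi> T) \<Phi>T)"

section \<open>Geometric control condition\<close>

text \<open>
  \<open>reflect p\<close> is specular reflection at the boundary point \<open>p\<close> of the cube: the component of the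
  velocity normal to each face containing \<open>p\<close> is reversed. It is the identity for interior \<open>p\<close>.
\<close>

definition reflect :: "real ^ 'n::finite \<Rightarrow> real ^ 'n \<Rightarrow> real ^ 'n" where
  "reflect p v = (\<chi> i. if p $ i = 0 \<or> p $ i = 1 then - (v $ i) else v $ i)"

text \<open>
  Unit-speed billiard trajectories: \<open>v\<close> is the velocity just before time \<open>t\<close>.
  The condition that the ray meets the open cube excludes lines gliding inside a face.
\<close>

definition optical_ray :: "(real \<Rightarrow> real ^ 'n::finite) \<Rightarrow> bool" where
  "optical_ray \<gamma> \<longleftrightarrow>
     (\<forall>t. \<gamma> t \<in> closure unit_cube) \<and> (\<exists>t. \<gamma> t \<in> unit_cube) \<and>
     (\<forall>t. \<exists>v \<delta>. \<delta> > 0 \<and> norm v = 1 \<and>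
        (\<forall>s\<in>{t-\<delta>..t}. \<gamma> s = \<gamma> t + (s - t) *\<^sub>R v) \<and>
        (\<forall>s\<in>{t..t+\<delta>}. \<gamma> s = \<gamma> t + (s - t) *\<^sub>R reflect (\<gamma> t) v))"

definition geometric_control_condition :: "(real ^ 'n::finite) set \<Rightarrow> real \<Rightarrow> bool" where
  "geometric_control_condition \<omega> T \<longleftrightarrow>
     (\<forall>\<gamma>. optical_ray \<gamma> \<longrightarrow> (\<exists>t. 0 < t \<and> t < T \<and> \<gamma> t \<in> \<omega>))"

section \<open>Dirichlet eigenfunctions\<close>

definition sine_mode :: "nat ^ 'n::finite \<Rightarrow> real ^ 'n \<Rightarrow> real" where
  "sine_mode k x = 2 powr (real CARD('n) / 2) * (\<Prod>i\<in>UNIV. sin (real (k $ i) * pi * x $ i))"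

definition multi_indices :: "(nat ^ 'n::finite) set" where
  "multi_indices = {k. \<forall>i. 1 \<le> k $ i}"

definition mode_less :: "nat ^ 'n::{finite,linorder} \<Rightarrow> nat ^ 'n::{finite,linorder} \<Rightarrow> bool" where
  "mode_less k l \<longleftrightarrow>
     (\<Sum>i\<in>UNIV. (k $ i)\<^sup>2) < (\<Sum>i\<in>UNIV. (l $ i)\<^sup>2) \<or>
     (\<Sum>i\<in>UNIV. (k $ i)\<^sup>2) = (\<Sum>i\<in>UNIV. (l $ i)\<^sup>2) \<and>
       (\<exists>i. k $ i < l $ i \<and> (\<forall>j<i. k $ j = l $ j))"

definition mode_position :: "nat ^ 'n::{finite,linorder} \<Rightarrow> nat" where
  "mode_position k = Suc (card {l \<in> multi_indices. mode_less l k})"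

text \<open>The enumeration starts at \<open>j = 1\<close>.\<close>

definition mode_index :: "nat \<Rightarrow> nat ^ 'n::{finite,linorder}" where
  "mode_index j = (THE k. k \<in> multi_indices \<and> mode_position k = j)"

definition eigenfunction :: "nat \<Rightarrow> real ^ 'n::{finite,linorder} \<Rightarrow> real" where
  "eigenfunction j = sine_mode (mode_index j)"

lemma mode_less_irrefl: "\<not> mode_less k k"
  by (simp add: mode_less_def)

lemma mode_less_trans:
  assumes "mode_less k l" "mode_less l m"
  shows "mode_less k m"
proof -
  have lex: "\<exists>i. k $ i < m $ i \<and> (\<forall>j<i. k $ j = m $ j)"
    if "k $ i < l $ i" "\<forall>j<i. k $ j = l $ j" "l $ i' < m $ i'" "\<forall>j<i'. l $ j = m $ j" for i i'
  proof (cases i i' rule: linorder_cases)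
    case less
    then show ?thesis using that by (intro exI[of _ i]) auto
  next
    case equal
    then show ?thesis using that by (intro exI[of _ i]) auto
  next
    case greater
    then show ?thesis using that by (intro exI[of _ i']) auto
  qed
  show ?thesis
    using assms lex unfolding mode_less_def by (smt (verit, best) order.strict_trans)
qed

lemma mode_less_total:
  assumes "k \<noteq> l"
  shows "mode_less k l \<or> mode_less l k"
proof -
  let ?D = "{i. k $ i \<noteq> l $ i}"
  have "?D \<noteq> {}" using assms by (auto simp: vec_eq_iff)
  then have min: "Min ?D \<in> ?D" by (intro Min_in) auto
  have eq: "k $ j = l $ j" if "j < Min ?D" for j
  proof (rule ccontr)
    assume "k $ j \<noteq> l $ j"
    then have "Min ?D \<le> j" by (intro Min_le) auto
    then show False using that by simp
  qed
  have "k $ Min ?D < l $ Min ?D \<or> l $ Min ?D < k $ Min ?D" using min by auto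
  then have "(\<exists>i. k $ i < l $ i \<and> (\<forall>j<i. k $ j = l $ j)) \<or> (\<exists>i. l $ i < k $ i \<and> (\<forall>j<i. l $ j = k $ j))"
    using eq by (metis (no_types, lifting))
  then show ?thesis unfolding mode_less_def by (auto simp: linorder_neq_iff)
qed

lemma finite_mode_segment:
  fixes k :: "nat ^ 'n::{finite,linorder}"
  shows "finite {l \<in> multi_indices. mode_less l k}"
proof -
  let ?s = "\<Sum>i\<in>UNIV. (k $ i)\<^sup>2"
  have "{l. mode_less l k} \<subseteq> vec_lambda ` (UNIV \<rightarrow> {..?s})"
  proof
    fix l assume "l \<in> {l. mode_less l k}"
    then have le: "(\<Sum>i\<in>UNIV. (l $ i)\<^sup>2) \<le> ?s" by (auto simp: mode_less_def)
    have "l $ i \<le> ?s" for i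
    proof -
      have "l $ i \<le> (l $ i)\<^sup>2" by (simp add: power2_eq_square)
      also have "\<dots> \<le> (\<Sum>i\<in>UNIV. (l $ i)\<^sup>2)" by (intro member_le_sum) auto
      finally show ?thesis using le by simp
    qed
    then have "l = vec_lambda (\<lambda>i. l $ i)" "(\<lambda>i. l $ i) \<in> UNIV \<rightarrow> {..?s}" by auto
    then show "l \<in> vec_lambda ` (UNIV \<rightarrow> {..?s})" by (rule image_eqI)
  qed
  moreover have "finite ((UNIV :: 'n set) \<rightarrow> {..?s})"
    unfolding PiE_UNIV_domain[symmetric] by (intro finite_PiE) simp_all
  ultimately have "finite {l. mode_less l k}" by (rule finite_subset[OF _ finite_imageI])
  then show ?thesis by (rule rev_finite_subset) auto
qed

lemma mode_position_strict:
  assumes "k \<in> multi_indices" "mode_less k l"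
  shows "mode_position k < mode_position l"
proof -
  have "{m \<in> multi_indices. mode_less m k} \<subset> {m \<in> multi_indices. mode_less m l}"
    using assms mode_less_trans mode_less_irrefl by blast
  then show ?thesis
    unfolding mode_position_def by (simp add: psubset_card_mono finite_mode_segment)
qed

lemma inj_on_mode_position: "inj_on mode_position multi_indices"
  by (metis inj_onI less_irrefl mode_less_total mode_position_strict)

lemma infinite_multi_indices: "infinite (multi_indices :: (nat ^ 'n::{finite,linorder}) set)"
proof -
  have "inj (\<lambda>n. (\<chi> i. Suc n) :: nat ^ 'n::{finite,linorder})" by (auto simp: inj_on_def vec_eq_iff)
  then have "infinite (range (\<lambda>n. (\<chi> i. Suc n) :: nat ^ 'n::{finite,linorder}))" by (rule range_inj_infinite)
  moreover have "range (\<lambda>n. (\<chi> i. Suc n) :: nat ^ 'n::{finite,linorder}) \<subseteq> multi_indices"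
    by (auto simp: multi_indices_def)
  ultimately show ?thesis using finite_subset by blast
qed

lemma mode_position_down:
  fixes k :: "nat ^ 'n::{finite,linorder}"
  assumes "k \<in> multi_indices" "mode_position k = Suc (Suc n)"
  shows "\<exists>l\<in>multi_indices :: (nat ^ 'n::{finite,linorder}) set. mode_position l = Suc n"
proof -
  let ?S = "{l \<in> multi_indices. mode_less l k}"
  have "?S \<noteq> {}" using assms(2) by (auto simp: mode_position_def simp del: Collect_empty_eq)
  then have "Max (mode_position ` ?S) \<in> mode_position ` ?S"
    by (intro Max_in) (simp_all add: finite_mode_segment)
  then obtain l where l: "l \<in> ?S" "mode_position l = Max (mode_position ` ?S)" by force
  have "?S = insert l {m \<in> multi_indices. mode_less m l}"
  proof (intro equalityI subsetI)
    fix m assume m: "m \<in> ?S"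
    then have "mode_position m \<le> mode_position l"
      unfolding l(2) by (intro Max_ge) (simp_all add: finite_mode_segment)
    then have "\<not> mode_less l m" using l(1) mode_position_strict by fastforce
    then show "m \<in> insert l {m \<in> multi_indices. mode_less m l}" using m mode_less_total by blast
  next
    fix m assume "m \<in> insert l {m \<in> multi_indices. mode_less m l}"
    then show "m \<in> ?S" using l(1) mode_less_trans by blast
  qed
  then have "card ?S = mode_position l"
    by (simp add: mode_position_def finite_mode_segment mode_less_irrefl)
  then have "mode_position l = Suc n" using assms(2) unfolding mode_position_def[of k] by linarith
  then show ?thesis using l(1) by blast
qed

lemma bij_betw_mode_position:
  "bij_betw mode_position (multi_indices :: (nat ^ 'n::{finite,linorder}) set) {1..}"
proof -
  let ?R = "mode_position ` (multi_indices :: (nat ^ 'n::{finite,linorder}) set)"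
  have inf: "infinite ?R"
    using infinite_multi_indices inj_on_mode_position finite_imageD by blast
  have down: "Suc n \<in> ?R" if "Suc (n + d) \<in> ?R" for n d
    using that
  proof (induction d)
    case (Suc d)
    then obtain k :: "nat ^ 'n::{finite,linorder}" where "k \<in> multi_indices" "mode_position k = Suc (Suc (n + d))"
      by auto
    from mode_position_down[OF this] have "Suc (n + d) \<in> ?R" by force
    then show ?case by (rule Suc.IH)
  qed simp
  have "Suc n \<in> ?R" for n
  proof -
    obtain r where "r \<in> ?R" "Suc n < r" using inf by (meson infinite_nat_iff_unbounded)
    then show ?thesis using down[of n "r - Suc n"] by simp
  qed
  then have "{1..} \<subseteq> ?R" by (metis One_nat_def Suc_le_D atLeast_iff subsetI)
  moreover have "?R \<subseteq> {1..}" by (auto simp: mode_position_def)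
  ultimately show ?thesis by (simp add: bij_betw_def inj_on_mode_position)
qed

lemma mode_index_position:
  fixes k :: "nat ^ 'n::{finite,linorder}"
  assumes "k \<in> multi_indices"
  shows "mode_index (mode_position k) = k"
  unfolding mode_index_def
  using assms inj_on_mode_position by (intro the_equality) (auto dest: inj_onD)

lemma bij_betw_mode_index:
  "bij_betw mode_index {1..} (multi_indices :: (nat ^ 'n::{finite,linorder}) set)"
proof (rule bij_betw_byWitness[where f' = mode_position])
  have R: "mode_position ` (multi_indices :: (nat ^ 'n::{finite,linorder}) set) = {1..}"
    using bij_betw_mode_position by (rule bij_betw_imp_surj_on)
  show "\<forall>j\<in>{1..}. mode_position (mode_index j :: nat ^ 'n::{finite,linorder}) = j"
    unfolding R[symmetric] by (auto simp: mode_index_position)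
  show "\<forall>k\<in>multi_indices. mode_index (mode_position k) = (k :: nat ^ 'n::{finite,linorder})"
    by (simp add: mode_index_position)
  show "mode_index ` {1..} \<subseteq> (multi_indices :: (nat ^ 'n::{finite,linorder}) set)"
    unfolding R[symmetric] by (auto simp: mode_index_position)
  show "mode_position ` (multi_indices :: (nat ^ 'n::{finite,linorder}) set) \<subseteq> {1..}"
    by (simp add: R)
qed

lemma mode_index_mono:
  assumes "1 \<le> i" "i < j"
  shows "mode_less (mode_index i :: nat ^ 'n::{finite,linorder}) (mode_index j)"
proof -
  have R: "mode_position ` (multi_indices :: (nat ^ 'n::{finite,linorder}) set) = {1..}"
    using bij_betw_mode_position by (rule bij_betw_imp_surj_on)
  have "i \<in> mode_position ` (multi_indices :: (nat ^ 'n::{finite,linorder}) set)"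
    "j \<in> mode_position ` (multi_indices :: (nat ^ 'n::{finite,linorder}) set)"
    unfolding R using assms by auto
  then obtain k l :: "nat ^ 'n::{finite,linorder}" where kl: "k \<in> multi_indices" "mode_position k = i"
    "l \<in> multi_indices" "mode_position l = j" by auto
  have "mode_less k l"
    using mode_less_total[of k l] mode_position_strict[of l k] kl assms(2) by force
  then show ?thesis using kl mode_index_position by metis
qed

end

theory Submission
  imports Defs
begin

text \<open>
  The control \<open>f\<close> is an element of \<open>L\<^sup>2((0,T) \<times> \<omega>)\<close>, and what is to be shown is a density
  statement in that space. Indeed, as the first component of the error is zero, its norm in
  \<open>L\<^sup>2((0,T); H\<^sub>0\<^sup>1 \<times> L\<^sup>2)\<close> is the norm of \<open>(f_net - f) 1\<^sub>\<omega>\<close> in \<open>L\<^sup>2((0,T) \<times> \<Omega>)\<close>. So it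
  suffices that finite sums \<open>\<Sum>\<^sub>j N\<^sub>j(t) e\<^sub>j(x)\<close>, with \<open>N\<^sub>j\<close> a network with one hidden layer,
  are dense in \<open>L\<^sup>2((0,T) \<times> \<Omega>)\<close>. This splits into a statement about \<open>t\<close>, one about \<open>x\<close> and
  the translation of norms.

  In \<open>t\<close> (\<open>network_limit_continuous\<close>): networks with a continuous non-polynomial activation are
  dense in the continuous functions on compact intervals. Differentiating \<open>\<sigma>(w t + b)\<close> in the
  weight \<open>w\<close> produces factors \<open>t\<close>; with \<open>\<sigma>\<close> replaced by local averages, \<open>k\<close> such steps show that
  \<open>t\<^sup>k\<close> times a \<open>k\<close>-fold finite difference of \<open>\<sigma>\<close> is a limit of networks. If \<open>t\<^sup>k\<close> itself
  were not a limit, all \<open>k\<close>-fold differences of \<open>\<sigma>\<close> would vanish, and \<open>\<sigma>\<close> would be a polynomial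
  (\<open>iterated_differences_zero_imp_poly\<close>). Weierstrass' theorem completes the argument.

  In \<open>x\<close> (\<open>ground_mode_mult_dense\<close>, \<open>modal_sum_dense\<close>): the sums \<open>\<Sum>\<^sub>k a\<^sub>k(t) e\<^sub>k(x)\<close> with continuous
  \<open>a\<^sub>k\<close> form a module over the algebra generated by the functions of \<open>t\<close> and the \<open>cos(\<pi> x\<^sub>i)\<close>. By
  Stone and Weierstrass, that algebra approximates every continuous function uniformly, so the
  module approximates every product of a continuous function with the ground mode. The ground mode
  is positive in the open cube, whence density in \<open>L\<^sup>2\<close>.

  For the norms (\<open>L2_energy_velocity\<close>), Fubini's theorem is applied to Borel representatives, and
  the chosen weak gradient of the zero function has to be identified as zero almost everywhere.
  This is the fundamental lemma of the calculus of variations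
  (\<open>fundamental_lemma_unit_cube\<close>).
\<close>

section \<open>Networks with one hidden layer and their locally uniform limits\<close>

definition networks :: "(real \<Rightarrow> real) \<Rightarrow> (real \<Rightarrow> real) set" where
  "networks \<sigma> = {N. \<exists>m a w b. N = (\<lambda>s. \<Sum>i<(m::nat). a i * \<sigma> (w i * s + b i))}"

definition network_limit :: "(real \<Rightarrow> real) \<Rightarrow> (real \<Rightarrow> real) \<Rightarrow> bool" where
  "network_limit \<sigma> \<rho> \<longleftrightarrow>
     (\<forall>R. \<forall>\<epsilon>>0. \<exists>N\<in>networks \<sigma>. \<forall>s. \<bar>s\<bar> \<le> R \<longrightarrow> \<bar>\<rho> s - N s\<bar> < \<epsilon>)"

lemma networksI: "(\<lambda>s. \<Sum>i<(m::nat). a i * \<sigma> (w i * s + b i)) \<in> networks \<sigma>"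
  by (auto simp: networks_def)

lemma networks_zero: "(\<lambda>s. 0) \<in> networks \<sigma>"
  using networksI[where m = 0] by simp

lemma networks_unit: "(\<lambda>s. a * \<sigma> (w * s + b)) \<in> networks \<sigma>"
  using networksI[of "\<lambda>i. a" \<sigma> "\<lambda>i. w" "\<lambda>i. b" 1] by simp

lemma networks_scale:
  assumes "N \<in> networks \<sigma>"
  shows "(\<lambda>s. c * N s) \<in> networks \<sigma>"
proof -
  obtain m a w b where N: "N = (\<lambda>s. \<Sum>i<(m::nat). a i * \<sigma> (w i * s + b i))"
    using assms by (auto simp: networks_def)
  show ?thesis
    using networksI[of "\<lambda>i. c * a i" \<sigma> w b m] by (simp add: N sum_distrib_left mult.assoc)
qed

lemma networks_add:
  assumes "N \<in> networks \<sigma>" "N' \<in> networks \<sigma>"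
  shows "(\<lambda>s. N s + N' s) \<in> networks \<sigma>"
proof -
  obtain m a w b where N: "N = (\<lambda>s. \<Sum>i<(m::nat). a i * \<sigma> (w i * s + b i))"
    using assms by (auto simp: networks_def)
  obtain m' a' w' b' where N': "N' = (\<lambda>s. \<Sum>i<(m'::nat). a' i * \<sigma> (w' i * s + b' i))"
    using assms by (auto simp: networks_def)
  let ?j = "\<lambda>p q i. if i < m then p i else q (i - m)"
  have split: "(\<Sum>i<m + m'. F i) = (\<Sum>i<m. F i) + (\<Sum>i<m'. F (m + i))" for F :: "nat \<Rightarrow> real"
    by (induction m') auto
  have "(\<lambda>s. N s + N' s)
      = (\<lambda>s. \<Sum>i<m + m'. ?j a a' i * \<sigma> (?j w w' i * s + ?j b b' i))"
    unfolding split by (simp add: N N')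
  then show ?thesis using networksI[of "?j a a'" \<sigma> "?j w w'" "?j b b'" "m + m'"] by simp
qed

text \<open>
  Hidden units with output weight zero can be added, so several networks can be given
  the same width.
\<close>

lemma networks_padded_width:
  assumes "N \<in> networks \<sigma>"
  obtains m a w b where "\<And>n. m \<le> n \<Longrightarrow> N = (\<lambda>s. \<Sum>i<(n::nat). a i * \<sigma> (w i * s + b i))"
proof -
  obtain m a w b where N: "N = (\<lambda>s. \<Sum>i<(m::nat). a i * \<sigma> (w i * s + b i))"
    using assms by (auto simp: networks_def)
  have "N = (\<lambda>s. \<Sum>i<n. (if i < m then a i else 0) * \<sigma> (w i * s + b i))" if "m \<le> n" for n
    unfolding N using that by (intro ext sum.mono_neutral_cong_left) auto
  then show ?thesis using that[of m "\<lambda>i. if i < m then a i else 0" w b] by blast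
qed

lemma network_limitI_limit:
  assumes "\<And>R \<epsilon>. \<epsilon> > 0 \<Longrightarrow> \<exists>\<rho>'. network_limit \<sigma> \<rho>' \<and> (\<forall>s. \<bar>s\<bar> \<le> R \<longrightarrow> \<bar>\<rho> s - \<rho>' s\<bar> < \<epsilon>)"
  shows "network_limit \<sigma> \<rho>"
  unfolding network_limit_def
proof (intro allI impI)
  fix R \<epsilon> :: real assume "\<epsilon> > 0"
  then obtain \<rho>' where \<rho>': "network_limit \<sigma> \<rho>'" "\<And>s. \<bar>s\<bar> \<le> R \<Longrightarrow> \<bar>\<rho> s - \<rho>' s\<bar> < \<epsilon> / 2"
    using assms[of "\<epsilon> / 2" R] by auto
  obtain N where N: "N \<in> networks \<sigma>" "\<And>s. \<bar>s\<bar> \<le> R \<Longrightarrow> \<bar>\<rho>' s - N s\<bar> < \<epsilon> / 2"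
    using \<rho>'(1) \<open>\<epsilon> > 0\<close> unfolding network_limit_def by (meson half_gt_zero)
  have "\<bar>\<rho> s - N s\<bar> < \<epsilon>" if "\<bar>s\<bar> \<le> R" for s
    using \<rho>'(2)[OF that] N(2)[OF that] by linarith
  then show "\<exists>N\<in>networks \<sigma>. \<forall>s. \<bar>s\<bar> \<le> R \<longrightarrow> \<bar>\<rho> s - N s\<bar> < \<epsilon>" using N(1) by blast
qed

lemma network_limit_network: "N \<in> networks \<sigma> \<Longrightarrow> network_limit \<sigma> N"
  unfolding network_limit_def by force

lemma network_limit_add:
  assumes "network_limit \<sigma> \<rho>" "network_limit \<sigma> \<rho>'"
  shows "network_limit \<sigma> (\<lambda>s. \<rho> s + \<rho>' s)"
  unfolding network_limit_def
proof (intro allI impI)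
  fix R \<epsilon> :: real assume "\<epsilon> > 0"
  then have e: "\<epsilon> / 2 > 0" by simp
  obtain N where N: "N \<in> networks \<sigma>" "\<And>s. \<bar>s\<bar> \<le> R \<Longrightarrow> \<bar>\<rho> s - N s\<bar> < \<epsilon> / 2"
    using assms(1) e unfolding network_limit_def by meson
  obtain N' where N': "N' \<in> networks \<sigma>" "\<And>s. \<bar>s\<bar> \<le> R \<Longrightarrow> \<bar>\<rho>' s - N' s\<bar> < \<epsilon> / 2"
    using assms(2) e unfolding network_limit_def by meson
  have "\<bar>\<rho> s + \<rho>' s - (N s + N' s)\<bar> < \<epsilon>" if "\<bar>s\<bar> \<le> R" for s
    using N(2)[OF that] N'(2)[OF that] by linarith
  then show "\<exists>N\<in>networks \<sigma>. \<forall>s. \<bar>s\<bar> \<le> R \<longrightarrow> \<bar>\<rho> s + \<rho>' s - N s\<bar> < \<epsilon>"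
    using networks_add[OF N(1) N'(1)] by (intro bexI) auto
qed

lemma network_limit_scale:
  assumes "network_limit \<sigma> \<rho>"
  shows "network_limit \<sigma> (\<lambda>s. c * \<rho> s)"
  unfolding network_limit_def
proof (intro allI impI)
  fix R \<epsilon> :: real assume "\<epsilon> > 0"
  then have e: "\<epsilon> / (\<bar>c\<bar> + 1) > 0" by simp
  obtain N where N: "N \<in> networks \<sigma>" "\<And>s. \<bar>s\<bar> \<le> R \<Longrightarrow> \<bar>\<rho> s - N s\<bar> < \<epsilon> / (\<bar>c\<bar> + 1)"
    using assms(1) e unfolding network_limit_def by meson
  have "\<bar>c * \<rho> s - c * N s\<bar> < \<epsilon>" if "\<bar>s\<bar> \<le> R" for s
  proof -
    have "\<bar>c * \<rho> s - c * N s\<bar> = \<bar>c\<bar> * \<bar>\<rho> s - N s\<bar>" by (simp add: abs_mult flip: right_diff_distrib)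
    also have "\<dots> \<le> \<bar>c\<bar> * (\<epsilon> / (\<bar>c\<bar> + 1))" using N(2)[OF that] by (intro mult_left_mono) auto
    also have "\<dots> < \<epsilon>" using \<open>\<epsilon> > 0\<close> by (simp add: field_simps)
    finally show ?thesis .
  qed
  then show "\<exists>N\<in>networks \<sigma>. \<forall>s. \<bar>s\<bar> \<le> R \<longrightarrow> \<bar>c * \<rho> s - N s\<bar> < \<epsilon>"
    using networks_scale[OF N(1)] by (intro bexI) auto
qed

lemma network_limit_sum:
  assumes "\<And>i. i \<in> I \<Longrightarrow> network_limit \<sigma> (\<rho> i)"
  shows "network_limit \<sigma> (\<lambda>s. \<Sum>i\<in>I. \<rho> i s)"
  using assms
proof (induction I rule: infinite_finite_induct)
  case (insert i I)
  then show ?case using network_limit_add[of \<sigma> "\<rho> i" "\<lambda>s. \<Sum>i\<in>I. \<rho> i s"] by simp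
qed (simp_all add: network_limit_network networks_zero)

section \<open>Differentiation with respect to the weight\<close>

text \<open>
  The induction hypothesis of the argument in \<open>t\<close>: every affine reparametrisation of \<open>\<psi>\<close>,
  multiplied by \<open>t\<^sup>j\<close>, is a limit of networks. Quantifying over all weights \<open>w\<close> is what allows
  differentiation with respect to \<open>w\<close>.
\<close>

definition multiplied_limit :: "(real \<Rightarrow> real) \<Rightarrow> nat \<Rightarrow> (real \<Rightarrow> real) \<Rightarrow> bool" where
  "multiplied_limit \<sigma> j \<psi> \<longleftrightarrow> (\<forall>w b. network_limit \<sigma> (\<lambda>t. t ^ j * \<psi> (w * t + b)))"

lemma continuous_uniform_on_bounded:
  fixes \<psi> :: "real \<Rightarrow> real"
  assumes "continuous_on UNIV \<psi>" "\<epsilon> > 0"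
  obtains \<delta> where "\<delta> > 0" "\<And>x y. \<bar>x\<bar> \<le> R \<Longrightarrow> \<bar>y\<bar> \<le> R \<Longrightarrow> \<bar>x - y\<bar> < \<delta> \<Longrightarrow> \<bar>\<psi> x - \<psi> y\<bar> < \<epsilon>"
proof -
  have "uniformly_continuous_on {-R..R} \<psi>"
    using assms(1) by (intro compact_uniformly_continuous) (auto intro: continuous_on_subset)
  then obtain \<delta> where "\<delta> > 0" and d: "\<And>x y. x \<in> {-R..R} \<Longrightarrow> y \<in> {-R..R} \<Longrightarrow> dist x y < \<delta> \<Longrightarrow> dist (\<psi> x) (\<psi> y) < \<epsilon>"
    using assms(2) unfolding uniformly_continuous_on_def by (metis dist_commute)
  have "\<bar>\<psi> x - \<psi> y\<bar> < \<epsilon>" if "\<bar>x\<bar> \<le> R" "\<bar>y\<bar> \<le> R" "\<bar>x - y\<bar> < \<delta>" for x y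
    using d[of x y] that by (auto simp: dist_real_def abs_le_iff)
  then show ?thesis using that \<open>\<delta> > 0\<close> by blast
qed

lemma affine_abs_bound:
  fixes w t b :: real
  assumes "\<bar>t\<bar> \<le> R"
  shows "\<bar>w * t + b\<bar> \<le> \<bar>w\<bar> * \<bar>R\<bar> + \<bar>b\<bar>"
proof -
  have "\<bar>w * t\<bar> \<le> \<bar>w\<bar> * \<bar>R\<bar>" unfolding abs_mult using assms by (intro mult_left_mono) auto
  then show ?thesis by linarith
qed

text \<open>
  An increment of the antiderivative is \<open>\<integral>\<^sub>0\<^sup>h \<psi>(s + u) du\<close>, a limit of Riemann sums of translates
  of \<open>\<psi>\<close>, and translates are permitted by the bias. This step gains the derivative that the next
  lemma spends.
\<close>

lemma multiplied_limit_increment: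
  assumes \<psi>: "continuous_on UNIV \<psi>" and \<Psi>: "\<And>x. (\<Psi> has_real_derivative \<psi> x) (at x)"
    and lim: "multiplied_limit \<sigma> j \<psi>" and "h > 0"
  shows "multiplied_limit \<sigma> j (\<lambda>s. \<Psi> (s + h) - \<Psi> s)"
  unfolding multiplied_limit_def
proof (intro allI, rule network_limitI_limit)
  fix w b R \<epsilon> :: real assume "\<epsilon> > 0"
  define K where "K = \<bar>w\<bar> * \<bar>R\<bar> + \<bar>b\<bar> + h"
  define C where "C = \<bar>R\<bar> ^ j * h + 1"
  have "C > 0" using \<open>h > 0\<close> by (auto simp: C_def intro!: add_nonneg_pos)
  obtain \<delta> where \<delta>: "\<delta> > 0"
    "\<And>x y. \<bar>x\<bar> \<le> K \<Longrightarrow> \<bar>y\<bar> \<le> K \<Longrightarrow> \<bar>x - y\<bar> < \<delta> \<Longrightarrow> \<bar>\<psi> x - \<psi> y\<bar> < \<epsilon> / C"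
    using continuous_uniform_on_bounded[OF \<psi>, of "\<epsilon> / C" K] \<open>\<epsilon> > 0\<close> \<open>C > 0\<close> by auto
  obtain n :: nat where n: "h / \<delta> < real n" using reals_Archimedean2 by blast
  have n0: "real n > 0" using n \<open>h > 0\<close> \<open>\<delta> > 0\<close> by (smt (verit) divide_pos_pos)
  define d where "d = h / real n"
  have d: "0 < d" "d < \<delta>" "real n * d = h"
    using n n0 \<open>h > 0\<close> \<open>\<delta> > 0\<close> by (auto simp: d_def field_simps)
  let ?S = "\<lambda>s. \<Sum>i<n. d * \<psi> (s + real i * d)"
  have step: "\<bar>\<Psi> (s + h) - \<Psi> s - ?S s\<bar> \<le> h * (\<epsilon> / C)" if s: "\<bar>s\<bar> \<le> \<bar>w\<bar> * \<bar>R\<bar> + \<bar>b\<bar>" for s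
  proof -
    have "\<Psi> (s + h) - \<Psi> s = (\<Sum>i<n. \<Psi> (s + real (Suc i) * d) - \<Psi> (s + real i * d))"
      by (subst sum_lessThan_telescope) (use d(3) in simp)
    then have "\<bar>\<Psi> (s + h) - \<Psi> s - ?S s\<bar>
        = \<bar>\<Sum>i<n. \<Psi> (s + real (Suc i) * d) - \<Psi> (s + real i * d) - d * \<psi> (s + real i * d)\<bar>"
      by (simp add: sum_subtractf)
    also have "\<dots> \<le> (\<Sum>i<n. \<bar>\<Psi> (s + real (Suc i) * d) - \<Psi> (s + real i * d) - d * \<psi> (s + real i * d)\<bar>)"
      by (rule sum_abs)
    also have "\<dots> \<le> (\<Sum>i<n. d * (\<epsilon> / C))"
    proof (rule sum_mono)
      fix i assume "i \<in> {..<n}"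
      then have "real (Suc i) * d \<le> h" using d by (subst d(3)[symmetric], intro mult_right_mono) auto
      have lt: "s + real i * d < s + real (Suc i) * d" using d by (simp add: algebra_simps)
      obtain z where z: "s + real i * d < z" "z < s + real (Suc i) * d"
        "\<Psi> (s + real (Suc i) * d) - \<Psi> (s + real i * d) = (s + real (Suc i) * d - (s + real i * d)) * \<psi> z"
        using MVT2[OF lt \<Psi>] by blast
      have eq: "\<Psi> (s + real (Suc i) * d) - \<Psi> (s + real i * d) - d * \<psi> (s + real i * d)
          = d * (\<psi> z - \<psi> (s + real i * d))"
        unfolding z(3) by (simp add: algebra_simps)
      have "0 \<le> real i * d" using d by simp
      have "\<bar>\<psi> z - \<psi> (s + real i * d)\<bar> < \<epsilon> / C"
      proof (rule \<delta>(2))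
        show "\<bar>z\<bar> \<le> K" "\<bar>s + real i * d\<bar> \<le> K"
          using z s \<open>real (Suc i) * d \<le> h\<close> \<open>0 \<le> real i * d\<close> lt unfolding K_def by linarith+
        show "\<bar>z - (s + real i * d)\<bar> < \<delta>"
          using z d by (auto simp: algebra_simps)
      qed
      then show "\<bar>\<Psi> (s + real (Suc i) * d) - \<Psi> (s + real i * d) - d * \<psi> (s + real i * d)\<bar> \<le> d * (\<epsilon> / C)"
        unfolding eq abs_mult using d by (intro mult_mono) auto
    qed
    also have "\<dots> = h * (\<epsilon> / C)" using d(3) by simp
    finally show ?thesis .
  qed
  have "network_limit \<sigma> (\<lambda>t. \<Sum>i<n. d * (t ^ j * \<psi> (w * t + (b + real i * d))))"
    using lim by (intro network_limit_sum network_limit_scale) (auto simp: multiplied_limit_def)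
  moreover have "\<bar>t ^ j * (\<Psi> (w * t + b + h) - \<Psi> (w * t + b))
      - (\<Sum>i<n. d * (t ^ j * \<psi> (w * t + (b + real i * d))))\<bar> < \<epsilon>" if t: "\<bar>t\<bar> \<le> R" for t
  proof -
    let ?s = "w * t + b"
    have "\<bar>t ^ j * (\<Psi> (?s + h) - \<Psi> ?s) - (\<Sum>i<n. d * (t ^ j * \<psi> (w * t + (b + real i * d))))\<bar>
        = \<bar>t ^ j * (\<Psi> (?s + h) - \<Psi> ?s - ?S ?s)\<bar>"
      by (simp add: right_diff_distrib sum_distrib_left ac_simps)
    also have "\<dots> = \<bar>t\<bar> ^ j * \<bar>\<Psi> (?s + h) - \<Psi> ?s - ?S ?s\<bar>" by (simp add: abs_mult power_abs)
    also have "\<dots> \<le> \<bar>R\<bar> ^ j * (h * (\<epsilon> / C))"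
      using t by (intro mult_mono power_mono step affine_abs_bound) auto
    also have "\<dots> < \<epsilon>"
      using \<open>\<epsilon> > 0\<close> \<open>C > 0\<close> by (simp add: field_simps C_def)
    finally show ?thesis .
  qed
  ultimately show "\<exists>\<rho>'. network_limit \<sigma> \<rho>' \<and>
      (\<forall>s. \<bar>s\<bar> \<le> R \<longrightarrow> \<bar>s ^ j * (\<Psi> (w * s + b + h) - \<Psi> (w * s + b)) - \<rho>' s\<bar> < \<epsilon>)" by blast
qed

text \<open>
  The derivative of \<open>\<Phi>(w t + b)\<close> in \<open>w\<close> is \<open>t \<phi>(w t + b)\<close>, and its difference quotients
  \<open>(\<Phi>((w + d) t + b) - \<Phi>(w t + b)) / d\<close> converge uniformly on bounded sets.
\<close>

lemma multiplied_limit_derivative: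
  assumes \<phi>: "continuous_on UNIV \<phi>" and \<Phi>: "\<And>x. (\<Phi> has_real_derivative \<phi> x) (at x)"
    and lim: "multiplied_limit \<sigma> j \<Phi>"
  shows "multiplied_limit \<sigma> (Suc j) \<phi>"
  unfolding multiplied_limit_def
proof (intro allI, rule network_limitI_limit)
  fix w b R \<epsilon> :: real assume "\<epsilon> > 0"
  define K where "K = (\<bar>w\<bar> + 1) * \<bar>R\<bar> + \<bar>b\<bar>"
  define C where "C = \<bar>R\<bar> ^ Suc j + 1"
  have "C > 0" by (auto simp: C_def intro!: add_nonneg_pos)
  obtain \<delta> where \<delta>: "\<delta> > 0"
    "\<And>x y. \<bar>x\<bar> \<le> K \<Longrightarrow> \<bar>y\<bar> \<le> K \<Longrightarrow> \<bar>x - y\<bar> < \<delta> \<Longrightarrow> \<bar>\<phi> x - \<phi> y\<bar> < \<epsilon> / C"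
    using continuous_uniform_on_bounded[OF \<phi>, of "\<epsilon> / C" K] \<open>\<epsilon> > 0\<close> \<open>C > 0\<close> by auto
  \<comment> \<open>the arguments \<open>(w + d) t + b\<close> then stay in \<open>[-K, K]\<close> and within \<open>\<delta>\<close> of \<open>w t + b\<close>\<close>
  define d where "d = min 1 (\<delta> / (2 * (\<bar>R\<bar> + 1)))"
  have d: "0 < d" "d \<le> 1" using \<delta>(1) by (auto simp: d_def)
  have "d * \<bar>R\<bar> \<le> \<delta> / (2 * (\<bar>R\<bar> + 1)) * \<bar>R\<bar>" by (intro mult_right_mono) (auto simp: d_def)
  also have "\<dots> < \<delta>" using \<delta>(1) by (simp add: field_simps add_strict_increasing2)
  finally have dR: "d * \<bar>R\<bar> < \<delta>" .
  have q: "\<bar>t * \<phi> (w * t + b) - (\<Phi> ((w + d) * t + b) - \<Phi> (w * t + b)) / d\<bar> \<le> \<bar>t\<bar> * (\<epsilon> / C)"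
    if t: "\<bar>t\<bar> \<le> R" for t
  proof (cases "t = 0")
    case False
    let ?x = "w * t + b" and ?y = "(w + d) * t + b"
    have "?x \<noteq> ?y" using False d by (simp add: algebra_simps)
    have Kx: "\<bar>?x\<bar> \<le> K"
      using affine_abs_bound[OF t, of w b] by (simp add: K_def algebra_simps)
    have Ky: "\<bar>?y\<bar> \<le> K"
    proof -
      have "\<bar>w + d\<bar> * \<bar>R\<bar> \<le> (\<bar>w\<bar> + 1) * \<bar>R\<bar>" using d by (intro mult_right_mono) auto
      then show ?thesis using affine_abs_bound[OF t, of "w + d" b] by (simp add: K_def)
    qed
    have xy: "\<bar>?y - ?x\<bar> < \<delta>"
    proof -
      have "\<bar>?y - ?x\<bar> = d * \<bar>t\<bar>" using d by (simp add: algebra_simps abs_mult)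
      also have "\<dots> \<le> d * \<bar>R\<bar>" using t d by (intro mult_left_mono) auto
      finally show ?thesis using dR by simp
    qed
    obtain z where z: "\<bar>z - ?x\<bar> \<le> \<bar>?y - ?x\<bar>" "\<bar>z\<bar> \<le> K" "\<Phi> ?y - \<Phi> ?x = (?y - ?x) * \<phi> z"
    proof (cases "?x < ?y")
      case True
      from MVT2[OF True \<Phi>] obtain z where "?x < z" "z < ?y" "\<Phi> ?y - \<Phi> ?x = (?y - ?x) * \<phi> z" by blast
      then show ?thesis using that[of z] Kx Ky by linarith
    next
      case False
      then have "?y < ?x" using \<open>?x \<noteq> ?y\<close> by linarith
      from MVT2[OF this \<Phi>] obtain z where z: "?y < z" "z < ?x" "\<Phi> ?x - \<Phi> ?y = (?x - ?y) * \<phi> z" by blast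
      have "\<Phi> ?y - \<Phi> ?x = (?y - ?x) * \<phi> z" using z(3) by (simp add: algebra_simps)
      then show ?thesis using that[of z] z Kx Ky by linarith
    qed
    have "\<Phi> ?y - \<Phi> ?x = d * t * \<phi> z" using z(3) by (simp add: algebra_simps)
    then have "t * \<phi> ?x - (\<Phi> ?y - \<Phi> ?x) / d = t * (\<phi> ?x - \<phi> z)"
      using d by (simp add: field_simps)
    then have "\<bar>t * \<phi> ?x - (\<Phi> ?y - \<Phi> ?x) / d\<bar> = \<bar>t\<bar> * \<bar>\<phi> ?x - \<phi> z\<bar>" by (simp add: abs_mult)
    also have "\<dots> \<le> \<bar>t\<bar> * (\<epsilon> / C)"
      using \<delta>(2)[OF Kx z(2)] z(1) xy by (intro mult_left_mono) (auto simp: abs_minus_commute)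
    finally show ?thesis .
  qed simp
  have "network_limit \<sigma> (\<lambda>t. (1 / d) * (t ^ j * \<Phi> ((w + d) * t + b)) + (- 1 / d) * (t ^ j * \<Phi> (w * t + b)))"
    using lim by (intro network_limit_add network_limit_scale) (auto simp: multiplied_limit_def)
  moreover have "\<bar>t ^ Suc j * \<phi> (w * t + b) -
      ((1 / d) * (t ^ j * \<Phi> ((w + d) * t + b)) + (- 1 / d) * (t ^ j * \<Phi> (w * t + b)))\<bar> < \<epsilon>"
    if t: "\<bar>t\<bar> \<le> R" for t
  proof -
    have "\<bar>t ^ Suc j * \<phi> (w * t + b) -
        ((1 / d) * (t ^ j * \<Phi> ((w + d) * t + b)) + (- 1 / d) * (t ^ j * \<Phi> (w * t + b)))\<bar>
        = \<bar>t ^ j * (t * \<phi> (w * t + b) - (\<Phi> ((w + d) * t + b) - \<Phi> (w * t + b)) / d)\<bar>"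
      using d by (simp add: field_simps)
    also have "\<dots> = \<bar>t\<bar> ^ j * \<bar>t * \<phi> (w * t + b) - (\<Phi> ((w + d) * t + b) - \<Phi> (w * t + b)) / d\<bar>"
      by (simp add: abs_mult power_abs)
    also have "\<dots> \<le> \<bar>t\<bar> ^ j * (\<bar>t\<bar> * (\<epsilon> / C))" using q[OF t] by (intro mult_left_mono) auto
    also have "\<dots> = \<bar>t\<bar> ^ Suc j * (\<epsilon> / C)" by simp
    also have "\<dots> \<le> \<bar>R\<bar> ^ Suc j * (\<epsilon> / C)"
      using t \<open>\<epsilon> > 0\<close> \<open>C > 0\<close> by (intro mult_right_mono power_mono) auto
    also have "\<dots> < \<epsilon>" using \<open>\<epsilon> > 0\<close> \<open>C > 0\<close> by (simp add: field_simps C_def)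
    finally show ?thesis .
  qed
  ultimately show "\<exists>\<rho>'. network_limit \<sigma> \<rho>' \<and>
      (\<forall>s. \<bar>s\<bar> \<le> R \<longrightarrow> \<bar>s ^ Suc j * \<phi> (w * s + b) - \<rho>' s\<bar> < \<epsilon>)" by blast
qed

text \<open>
  Averaging followed by differentiation gains one factor \<open>t\<close>. The price is a finite difference
  instead of a derivative, so the result is again only continuous and the step can be iterated.
\<close>

lemma multiplied_limit_difference:
  assumes \<psi>: "continuous_on UNIV \<psi>" and lim: "multiplied_limit \<sigma> j \<psi>" and "h > 0"
  shows "multiplied_limit \<sigma> (Suc j) (\<lambda>s. \<psi> (s + h) - \<psi> s)"
proof -
  obtain \<Psi> where \<Psi>: "\<And>x. (\<Psi> has_real_derivative \<psi> x) (at x)"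
    using einterval_antiderivative[of "-\<infinity>" "\<infinity>" \<psi>] \<psi>
    by (auto simp: continuous_on_eq_continuous_at has_real_derivative_iff_has_vector_derivative)
  show ?thesis
  proof (rule multiplied_limit_derivative)
    show "continuous_on UNIV (\<lambda>s. \<psi> (s + h) - \<psi> s)"
      by (intro continuous_intros continuous_on_compose2[OF \<psi>]) auto
    show "((\<lambda>s. \<Psi> (s + h) - \<Psi> s) has_real_derivative (\<psi> (x + h) - \<psi> x)) (at x)" for x
      by (intro DERIV_diff \<Psi>) (use DERIV_shift[of \<Psi> "\<psi> (x + h)" x h] \<Psi> in auto)
    show "multiplied_limit \<sigma> j (\<lambda>s. \<Psi> (s + h) - \<Psi> s)"
      by (rule multiplied_limit_increment[OF \<psi> \<Psi> lim \<open>h > 0\<close>])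
  qed
qed

text \<open>
  The steps may differ. With this freedom, the vanishing of all \<open>(k + 1)\<close>-fold differences of \<open>\<psi>\<close>
  is the vanishing of all \<open>k\<close>-fold differences of each first difference, which permits induction
  on \<open>k\<close>.
\<close>

primrec iterated_difference :: "real list \<Rightarrow> (real \<Rightarrow> real) \<Rightarrow> real \<Rightarrow> real" where
  "iterated_difference [] \<psi> = \<psi>"
| "iterated_difference (h # hs) \<psi> = iterated_difference hs (\<lambda>s. \<psi> (s + h) - \<psi> s)"

lemma multiplied_limit_iterated_difference:
  assumes "continuous_on UNIV \<psi>" "multiplied_limit \<sigma> j \<psi>" "\<forall>h\<in>set hs. h > 0"
  shows "multiplied_limit \<sigma> (j + length hs) (iterated_difference hs \<psi>)"
  using assms
proof (induction hs arbitrary: \<psi> j)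
  case (Cons h hs)
  have "continuous_on UNIV (\<lambda>s. \<psi> (s + h) - \<psi> s)"
    by (intro continuous_intros continuous_on_compose2[OF Cons.prems(1)]) auto
  then show ?case
    using Cons.IH[of "\<lambda>s. \<psi> (s + h) - \<psi> s" "Suc j"] multiplied_limit_difference[OF Cons.prems(1,2)] Cons.prems(3)
    by simp
qed simp

section \<open>Functions whose iterated differences vanish\<close>

lemma poly_shift_poly: "\<exists>q :: real poly. \<forall>s. poly p (s + h) = poly q s"
  by (rule exI[of _ "pcompose p [:h, 1:]"]) (simp add: poly_pcompose add.commute)

text \<open>
  The difference of \<open>c s\<^sup>n\<^sup>+\<^sup>1\<close> has degree \<open>n\<close> and leading coefficient \<open>c (n + 1)\<close>, so the leading
  term of \<open>p\<close> can be removed and the degree decreases.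
\<close>

lemma poly_unit_difference_surj:
  "\<exists>q :: real poly. \<forall>s. poly q (s + 1) - poly q s = poly p s"
proof (induction "degree p" arbitrary: p rule: less_induct)
  case less
  show ?case
  proof (cases "p = 0")
    case True
    then show ?thesis by (intro exI[of _ 0]) simp
  next
    case False
    define n where "n = degree p"
    define c where "c = lead_coeff p / real (Suc n)"
    \<comment> \<open>chosen so that the difference of \<open>q0\<close> has the leading term of \<open>p\<close>\<close>
    define q0 where "q0 = monom c (Suc n)"
    define d where "d = pcompose q0 [:1, 1:] - q0"
    have d: "poly d s = poly q0 (s + 1) - poly q0 s" for s
      by (simp add: d_def poly_pcompose add.commute)
    have deq: "d = (\<Sum>k\<le>n. monom (c * of_nat (Suc n choose k)) k)"
    proof (rule poly_eq_poly_eq_iff[THEN iffD1], rule ext)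
      fix s :: real
      have "(s + 1) ^ Suc n = (\<Sum>k\<le>Suc n. of_nat (Suc n choose k) * s ^ k)"
        using binomial_ring[of s 1 "Suc n"] by simp
      then have "(s + 1) ^ Suc n = (\<Sum>k\<le>n. of_nat (Suc n choose k) * s ^ k) + s ^ Suc n"
        by (simp only: sum.atMost_Suc binomial_n_n of_nat_1 mult_1_left)
      then have "poly d s = c * (\<Sum>k\<le>n. of_nat (Suc n choose k) * s ^ k)"
        unfolding d q0_def poly_monom by (simp only: distrib_left add_diff_cancel_right')
      then show "poly d s = poly (\<Sum>k\<le>n. monom (c * of_nat (Suc n choose k)) k) s"
        by (simp only: poly_sum poly_monom mult.assoc sum_distrib_left)
    qed
    have cd: "coeff d i = (if i \<le> n then c * of_nat (Suc n choose i) else 0)" for i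
      unfolding deq by (simp only: coeff_sum coeff_monom) (simp del: binomial_Suc_Suc)
    have "coeff (p - d) i = 0" if "i \<ge> n" for i
    proof (cases "i = n")
      case True
      then show ?thesis unfolding coeff_diff cd c_def
        by (simp add: n_def del: binomial_Suc_Suc of_nat_Suc)
    next
      case False
      then show ?thesis using that unfolding coeff_diff cd by (simp add: n_def coeff_eq_0)
    qed
    then have "p - d = 0 \<or> degree (p - d) < n"
      using leading_coeff_0_iff[of "p - d"] not_le by blast
    then obtain q1 where "\<And>s. poly q1 (s + 1) - poly q1 s = poly (p - d) s"
    proof
      assume "p - d = 0"
      then show ?thesis using that[of 0] by simp
    qed (use less[of "p - d"] that n_def in blast)
    then show ?thesis using d by (intro exI[of _ "q0 + q1"]) (simp add: algebra_simps)
  qed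
qed

lemma periodic_poly_constant:
  fixes r :: "real poly"
  assumes "\<And>s. poly r (s + 1) = poly r s"
  shows "poly r s = poly r 0"
proof -
  have n: "poly r (real n) = poly r 0" for n
  proof (induction n)
    case (Suc n)
    then show ?case using assms[of "real n"] by (simp add: add.commute)
  qed simp
  have "r - [:poly r 0:] = 0"
  proof (rule ccontr)
    assume "r - [:poly r 0:] \<noteq> 0"
    then have "finite {x. poly (r - [:poly r 0:]) x = 0}" by (rule poly_roots_finite)
    moreover have "range real \<subseteq> {x. poly (r - [:poly r 0:]) x = 0}" using n by auto
    moreover have "infinite (range real)" by (simp add: range_inj_infinite inj_of_nat)
    ultimately show False using finite_subset by blast
  qed
  then have "poly (r - [:poly r 0:]) s = 0" by simp
  then show ?thesis by simp
qed

lemma continuous_periodic_bounded: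
  fixes q :: "real \<Rightarrow> real"
  assumes "continuous_on UNIV q" "\<And>s. q (s + 1) = q s"
  obtains B where "\<And>s. \<bar>q s\<bar> \<le> B"
proof -
  have "bounded (q ` {0..1})"
    using assms(1) by (intro compact_imp_bounded compact_continuous_image) (auto intro: continuous_on_subset)
  then obtain B where B: "\<And>s. s \<in> {0..1} \<Longrightarrow> \<bar>q s\<bar> \<le> B" by (metis bounded_iff imageI real_norm_def)
  have nat: "q (s + real n) = q s" for s n
  proof (induction n)
    case (Suc n)
    then show ?case using assms(2)[of "s + real n"] by (simp add: ac_simps)
  qed simp
  have int: "q (s + of_int k) = q s" for s k
  proof (cases "k \<ge> 0")
    case True
    then show ?thesis using nat[of s "nat k"] by simp
  next
    case False
    then show ?thesis using nat[of "s + of_int k" "nat (- k)"] by simp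
  qed
  have "\<bar>q s\<bar> \<le> B" for s
  proof -
    have "q s = q (frac s)" using int[of "frac s" "\<lfloor>s\<rfloor>"] by (simp add: frac_def)
    then show ?thesis using B[of "frac s"] frac_lt_1[of s] by (simp add: less_imp_le)
  qed
  then show ?thesis by (rule that)
qed

text \<open>
  Subtracting a polynomial with the same difference of step \<open>1\<close> leaves a periodic function \<open>q\<close>. For
  any step \<open>h\<close>, the difference of \<open>q\<close> is a periodic polynomial, hence a constant; as \<open>q\<close> is bounded,
  that constant is \<open>0\<close>, and \<open>q\<close> is constant.
\<close>

lemma poly_differences_imp_poly:
  fixes \<psi> :: "real \<Rightarrow> real"
  assumes cont: "continuous_on UNIV \<psi>"
    and diff: "\<And>h. h > 0 \<Longrightarrow> \<exists>p :: real poly. \<forall>s. \<psi> (s + h) - \<psi> s = poly p s"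
  shows "\<exists>p :: real poly. \<psi> = poly p"
proof -
  obtain p1 :: "real poly" where p1: "\<And>s. \<psi> (s + 1) - \<psi> s = poly p1 s" using diff[of 1] by auto
  obtain p :: "real poly" where p: "\<And>s. poly p (s + 1) - poly p s = poly p1 s"
    using poly_unit_difference_surj by blast
  define q where "q s = \<psi> s - poly p s" for s
  have per: "q (s + 1) = q s" for s using p1[of s] p[of s] by (simp add: q_def)
  have "continuous_on UNIV q" unfolding q_def by (intro continuous_intros cont)
  then obtain B where B: "\<And>s. \<bar>q s\<bar> \<le> B" using continuous_periodic_bounded per by blast
  have pos: "q h = q 0" if "h > 0" for h
  proof -
    obtain r0 :: "real poly" where r0: "\<And>s. \<psi> (s + h) - \<psi> s = poly r0 s"
      using diff[of h] \<open>h > 0\<close> by blast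
    obtain s0 :: "real poly" where s0: "\<And>s. poly p (s + h) = poly s0 s" using poly_shift_poly by blast
    define r where "r = r0 - s0 + p"
    have r: "q (s + h) - q s = poly r s" for s
      using r0[of s] s0[of s] by (simp add: r_def q_def algebra_simps)
    have "poly r (s + 1) = poly r s" for s
      using r[of s] r[of "s + 1"] per[of s] per[of "s + h"] by (simp add: ac_simps)
    then have const: "q (s + h) - q s = poly r 0" for s using r periodic_poly_constant by metis
    have lin: "q (real n * h) = q 0 + real n * poly r 0" for n
    proof (induction n)
      case (Suc n)
      have "q (real (Suc n) * h) = q (real n * h + h)" by (simp add: algebra_simps)
      then show ?case using Suc const[of "real n * h"] by (simp add: algebra_simps)
    qed simp
    have "poly r 0 = 0"
    proof (rule ccontr)
      assume "poly r 0 \<noteq> 0"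
      then obtain n :: nat where n: "2 * B < real n * \<bar>poly r 0\<bar>"
        using ex_less_of_nat_mult[of "\<bar>poly r 0\<bar>" "2 * B"] by auto
      have "real n * \<bar>poly r 0\<bar> = \<bar>q (real n * h) - q 0\<bar>" using lin[of n] by (simp add: abs_mult)
      also have "\<dots> \<le> 2 * B" using B[of "real n * h"] B[of 0] by linarith
      finally show False using n by simp
    qed
    then show ?thesis using const[of 0] by simp
  qed
  have shift: "q (h + real n) = q h" for h n
  proof (induction n)
    case (Suc n)
    then show ?case using per[of "h + real n"] by (simp add: ac_simps)
  qed simp
  have "q h = q 0" for h
  proof -
    obtain n :: nat where "- h < real n" using reals_Archimedean2 by blast
    then show ?thesis using pos[of "h + real n"] shift[of h n] by simp
  qed
  then have "\<psi> = poly (p + [:q 0:])" by (auto simp: q_def fun_eq_iff algebra_simps)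
  then show ?thesis by blast
qed

lemma iterated_differences_zero_imp_poly:
  assumes "continuous_on UNIV \<psi>"
    and "\<And>hs s. length hs = k \<Longrightarrow> \<forall>h\<in>set hs. h > 0 \<Longrightarrow> iterated_difference hs \<psi> s = 0"
  shows "\<exists>p :: real poly. \<psi> = poly p"
  using assms
proof (induction k arbitrary: \<psi>)
  case 0
  then have "\<psi> s = 0" for s using 0(2)[of "[]"] by simp
  then show ?case by (intro exI[of _ 0]) auto
next
  case (Suc k)
  show ?case
  proof (rule poly_differences_imp_poly[OF Suc.prems(1)])
    fix h :: real assume "h > 0"
    have "continuous_on UNIV (\<lambda>s. \<psi> (s + h) - \<psi> s)"
      by (intro continuous_intros continuous_on_compose2[OF Suc.prems(1)]) auto
    moreover have "iterated_difference hs (\<lambda>s. \<psi> (s + h) - \<psi> s) s = 0"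
      if "length hs = k" "\<forall>h\<in>set hs. h > 0" for hs s
      using Suc.prems(2)[of "h # hs" s] that \<open>h > 0\<close> by simp
    ultimately have "\<exists>p :: real poly. (\<lambda>s. \<psi> (s + h) - \<psi> s) = poly p" by (rule Suc.IH)
    then show "\<exists>p :: real poly. \<forall>s. \<psi> (s + h) - \<psi> s = poly p s" by (simp add: fun_eq_iff)
  qed
qed

section \<open>Universal approximation on the line\<close>

text \<open>
  Evaluating at weight \<open>w = 0\<close> turns the iterated difference of \<open>\<sigma>\<close> into a nonzero number that
  multiplies \<open>t\<^sup>k\<close>.
\<close>

lemma network_limit_power:
  assumes \<sigma>: "continuous_on UNIV \<sigma>" "\<nexists>p :: real poly. \<sigma> = poly p"
  shows "network_limit \<sigma> (\<lambda>t. t ^ k)"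
proof -
  obtain hs s where hs: "length hs = k" "\<forall>h\<in>set hs. h > 0" "iterated_difference hs \<sigma> s \<noteq> 0"
    using iterated_differences_zero_imp_poly[OF \<sigma>(1), of k] \<sigma>(2) by blast
  have "multiplied_limit \<sigma> 0 \<sigma>"
    unfolding multiplied_limit_def using network_limit_network[OF networks_unit[of 1 \<sigma>]] by simp
  from multiplied_limit_iterated_difference[OF \<sigma>(1) this hs(2)]
  have "network_limit \<sigma> (\<lambda>t. t ^ k * iterated_difference hs \<sigma> (0 * t + s))"
    by (simp only: multiplied_limit_def hs(1) add_0)
  from network_limit_scale[OF this, of "1 / iterated_difference hs \<sigma> s"] hs(3) show ?thesis by simp
qed

theorem network_limit_continuous:
  assumes \<sigma>: "continuous_on UNIV \<sigma>" "\<nexists>p :: real poly. \<sigma> = poly p"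
    and \<rho>: "continuous_on UNIV \<rho>"
  shows "network_limit \<sigma> \<rho>"
proof (rule network_limitI_limit)
  fix R \<epsilon> :: real assume "\<epsilon> > 0"
  have "continuous_on {-R..R} \<rho>" using \<rho> continuous_on_subset by blast
  then obtain p where p: "real_polynomial_function p" "\<And>s. s \<in> {-R..R} \<Longrightarrow> \<bar>\<rho> s - p s\<bar> < \<epsilon>"
    using Stone_Weierstrass_real_polynomial_function[OF compact_Icc _ \<open>\<epsilon> > 0\<close>] by blast
  obtain a n where "p = (\<lambda>x. \<Sum>i\<le>n. a i * x ^ i)"
    using p(1) by (auto simp: real_polynomial_function_iff_sum)
  then have "network_limit \<sigma> p"
    by (auto intro!: network_limit_sum network_limit_scale network_limit_power \<sigma>)
  then show "\<exists>\<rho>'. network_limit \<sigma> \<rho>' \<and> (\<forall>s. \<bar>s\<bar> \<le> R \<longrightarrow> \<bar>\<rho> s - \<rho>' s\<bar> < \<epsilon>)"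
    using p(2) by (intro exI[of _ p]) (simp add: abs_le_iff)
qed

section \<open>Sums of sine modes with time-dependent coefficients\<close>

text \<open>
  Sums \<open>\<Sum>\<^sub>k a\<^sub>k(t) e\<^sub>k(x)\<close>, generated one term at a time so that closure properties follow by
  rule induction.
\<close>

inductive modal_sum :: "(real \<times> (real ^ 'n::finite) \<Rightarrow> real) \<Rightarrow> bool" where
  modal_sum_zero: "modal_sum (\<lambda>p. 0)"
| modal_sum_insert: "modal_sum u \<Longrightarrow> continuous_on UNIV a \<Longrightarrow> k \<in> multi_indices
    \<Longrightarrow> modal_sum (\<lambda>p. u p + a (fst p) * sine_mode k (snd p))"

lemma modal_sum_single:
  assumes "continuous_on UNIV a" "k \<in> multi_indices"
  shows "modal_sum (\<lambda>p. a (fst p) * sine_mode k (snd p))"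
  using modal_sum_insert[OF modal_sum_zero assms] by simp

lemma modal_sum_add:
  assumes "modal_sum u" "modal_sum v"
  shows "modal_sum (\<lambda>p. u p + v p)"
  using assms(2)
proof induction
  case modal_sum_zero
  then show ?case using assms(1) by simp
next
  case (modal_sum_insert v a k)
  then show ?case using modal_sum.modal_sum_insert[of "\<lambda>p. u p + v p" a k] by (simp add: add.assoc)
qed

lemma modal_sum_time_mult:
  assumes "modal_sum u" "continuous_on UNIV b"
  shows "modal_sum (\<lambda>p. b (fst p) * u p)"
  using assms(1)
proof induction
  case modal_sum_zero
  then show ?case using modal_sum.modal_sum_zero by simp
next
  case (modal_sum_insert u a k)
  have "continuous_on UNIV (\<lambda>t. b t * a t)" by (intro continuous_intros assms modal_sum_insert)
  from modal_sum.modal_sum_insert[OF modal_sum_insert(4) this modal_sum_insert(3)]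
  show ?case by (simp add: algebra_simps)
qed

definition vec_update :: "'a ^ 'n::finite \<Rightarrow> 'n \<Rightarrow> 'a \<Rightarrow> 'a ^ 'n" where
  "vec_update k i m = (\<chi> j. if j = i then m else k $ j)"

lemma sine_mode_split:
  "sine_mode (vec_update k i m) x = 2 powr (real CARD('n) / 2) *
     (sin (real m * pi * x $ i) * (\<Prod>j\<in>UNIV - {i}. sin (real (k $ j) * pi * x $ j)))"
  for k :: "nat ^ 'n::finite"
proof -
  have "(\<Prod>j\<in>UNIV. sin (real (vec_update k i m $ j) * pi * x $ j))
      = sin (real m * pi * x $ i) * (\<Prod>j\<in>UNIV - {i}. sin (real (vec_update k i m $ j) * pi * x $ j))"
    by (subst prod.remove[of UNIV i]) (auto simp: vec_update_def)
  also have "(\<Prod>j\<in>UNIV - {i}. sin (real (vec_update k i m $ j) * pi * x $ j))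
      = (\<Prod>j\<in>UNIV - {i}. sin (real (k $ j) * pi * x $ j))"
    by (intro prod.cong) (auto simp: vec_update_def)
  finally show ?thesis by (simp add: sine_mode_def)
qed

lemma vec_update_same: "vec_update k i (k $ i) = k"
  by (simp add: vec_update_def vec_eq_iff)

text \<open>
  \<open>2 sin(m \<theta>) cos \<theta> = sin((m + 1) \<theta>) + sin((m - 1) \<theta>)\<close> in the \<open>i\<close>-th factor.
\<close>

lemma sine_mode_mult_cos:
  fixes k :: "nat ^ 'n::finite"
  assumes "1 \<le> k $ i"
  shows "cos (pi * x $ i) * sine_mode k x
    = 1 / 2 * sine_mode (vec_update k i (k $ i + 1)) x + 1 / 2 * sine_mode (vec_update k i (k $ i - 1)) x"
proof -
  define m where "m = k $ i"
  define y where "y = pi * x $ i"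
  have "sin (real (m + 1) * y) + sin (real (m - 1) * y) = 2 * (sin (real m * y) * cos y)"
    using assms by (simp add: m_def of_nat_diff algebra_simps sin_add sin_diff)
  moreover have "sine_mode k x = sine_mode (vec_update k i m) x" by (simp add: m_def vec_update_same)
  ultimately show ?thesis
    unfolding sine_mode_split m_def[symmetric]
    by (simp only: y_def[symmetric] mult.assoc) algebra
qed

text \<open>
  The index \<open>0\<close>, which is no admissible multi-index, can occur for \<open>k\<^sub>i = 1\<close>; the corresponding
  sine vanishes.
\<close>

lemma modal_sum_cos_mult:
  fixes u :: "real \<times> (real ^ 'n::finite) \<Rightarrow> real"
  assumes "modal_sum u"
  shows "modal_sum (\<lambda>p. cos (pi * snd p $ i) * u p)"
  using assms
proof induction
  case modal_sum_zero
  then show ?case using modal_sum.modal_sum_zero by simp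
next
  case (modal_sum_insert u a k)
  let ?up = "vec_update k i (k $ i + 1)" and ?down = "vec_update k i (k $ i - 1)"
  have k: "1 \<le> k $ i" using modal_sum_insert by (simp add: multi_indices_def)
  have a: "continuous_on UNIV (\<lambda>t. a t * (1 / 2))" by (intro continuous_intros modal_sum_insert)
  have up: "modal_sum (\<lambda>p. a (fst p) * (1 / 2) * sine_mode ?up (snd p))"
    using modal_sum_insert by (intro modal_sum_single[OF a]) (auto simp: multi_indices_def vec_update_def)
  have down: "modal_sum (\<lambda>p. a (fst p) * (1 / 2) * sine_mode ?down (snd p))"
  proof (cases "k $ i = 1")
    case True
    then show ?thesis using modal_sum.modal_sum_zero by (simp add: sine_mode_split)
  next
    case False
    with k have "1 \<le> k $ i - 1" by simp
    then show ?thesis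
      using modal_sum_insert(3) by (intro modal_sum_single[OF a]) (simp add: multi_indices_def vec_update_def)
  qed
  have "cos (pi * snd p $ i) * (u p + a (fst p) * sine_mode k (snd p))
      = cos (pi * snd p $ i) * u p + (a (fst p) * (1 / 2) * sine_mode ?up (snd p)
          + a (fst p) * (1 / 2) * sine_mode ?down (snd p))" for p
  proof -
    have "cos (pi * snd p $ i) * (u p + a (fst p) * sine_mode k (snd p))
      = cos (pi * snd p $ i) * u p + a (fst p) * (cos (pi * snd p $ i) * sine_mode k (snd p))"
      by (simp add: algebra_simps)
    then show ?thesis unfolding sine_mode_mult_cos[OF k] by (simp add: distrib_left mult.assoc)
  qed
  then show ?case using modal_sum_add[OF modal_sum_insert.IH modal_sum_add[OF up down]] by simp
qed

lemma sine_mode_bound: "\<bar>sine_mode k x\<bar> \<le> 2 powr (real CARD('n) / 2)"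
  for x :: "real ^ 'n::finite"
proof -
  have "\<bar>\<Prod>i\<in>UNIV. sin (real (k $ i) * pi * x $ i)\<bar> \<le> 1"
    unfolding abs_prod by (intro prod_le_1) auto
  then show ?thesis by (simp add: sine_mode_def abs_mult mult_left_le)
qed

lemma continuous_on_sine_mode [continuous_intros]:
  "continuous_on A h \<Longrightarrow> continuous_on A (\<lambda>y :: 'a::t2_space. sine_mode k (h y))"
  unfolding sine_mode_def
  by (intro continuous_on_mult continuous_on_const continuous_on_prod continuous_on_sin continuous_on_component)

lemma modal_sum_continuous: "modal_sum u \<Longrightarrow> continuous_on UNIV u"
proof (induction rule: modal_sum.induct)
  case (modal_sum_insert u a k)
  then show ?case
    by (intro continuous_intros continuous_on_compose2[OF modal_sum_insert(2)]) auto
qed simp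

definition ground_mode :: "real ^ 'n::finite \<Rightarrow> real" where
  "ground_mode = sine_mode (\<chi> i. 1)"

lemma ground_mode_pos: "x \<in> unit_cube \<Longrightarrow> ground_mode x > 0"
  unfolding ground_mode_def sine_mode_def
  by (auto simp: unit_cube_def intro!: mult_pos_pos prod_pos sin_gt_zero)

text \<open>
  The functions that map modal sums to modal sums by multiplication form an algebra. It contains all
  continuous functions of \<open>t\<close> and all \<open>cos(\<pi> x\<^sub>i)\<close>, and these separate the points of the closed
  cylinder because the cosine is injective on \<open>[0, \<pi>]\<close>. The Stone--Weierstrass theorem applies to
  this algebra; multiplying the ground mode by its elements gives modal sums.
\<close>

lemma ground_mode_mult_dense:
  fixes c :: "real \<times> (real ^ 'n::finite) \<Rightarrow> real"
  assumes "continuous_on UNIV c" "\<epsilon> > 0"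
  shows "\<exists>u. modal_sum u \<and> (\<forall>p\<in>{0..T} \<times> cbox 0 1. \<bar>c p * ground_mode (snd p) - u p\<bar> < \<epsilon>)"
proof -
  \<comment> \<open>the multiplier algebra of the modal sums\<close>
  define R where "R = {q :: real \<times> (real ^ 'n) \<Rightarrow> real.
    continuous_on UNIV q \<and> (\<forall>u. modal_sum u \<longrightarrow> modal_sum (\<lambda>p. q p * u p))}"
  have time: "(\<lambda>p. b (fst p)) \<in> R" if "continuous_on UNIV b" for b
    using that by (auto simp: R_def modal_sum_time_mult intro!: continuous_on_compose2[OF that] continuous_intros)
  have cos: "(\<lambda>p. cos (pi * snd p $ i)) \<in> R" for i
    by (auto simp: R_def modal_sum_cos_mult intro!: continuous_intros)
  interpret R: function_ring_on R "{0..T} \<times> cbox 0 (1 :: real ^ 'n)"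
  proof
    show "compact ({0..T} \<times> cbox 0 (1 :: real ^ 'n))" by (intro compact_Times compact_Icc compact_cbox)
    show "continuous_on ({0..T} \<times> cbox 0 1) q" if "q \<in> R" for q
      using that by (auto simp: R_def intro: continuous_on_subset)
    fix q r assume qr: "q \<in> R" "r \<in> R"
    have "modal_sum (\<lambda>p. (q p + r p) * u p)" if "modal_sum u" for u
      using qr that modal_sum_add[of "\<lambda>p. q p * u p" "\<lambda>p. r p * u p"]
      by (simp add: R_def distrib_right)
    then show "(\<lambda>p. q p + r p) \<in> R" using qr by (auto simp: R_def intro!: continuous_intros)
    have "modal_sum (\<lambda>p. q p * r p * u p)" if "modal_sum u" for u
      using qr that by (simp add: R_def mult.assoc)
    then show "(\<lambda>p. q p * r p) \<in> R" using qr by (auto simp: R_def intro!: continuous_intros)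
  next
    show "(\<lambda>_. e) \<in> R" for e by (rule time) simp
  next
    fix p q :: "real \<times> (real ^ 'n)"
    assume pq: "p \<in> {0..T} \<times> cbox 0 1" "q \<in> {0..T} \<times> cbox 0 1" "p \<noteq> q"
    show "\<exists>f\<in>R. f p \<noteq> f q"
    proof (cases "fst p = fst q")
      case False
      then show ?thesis using time[of "\<lambda>t. t"] by auto
    next
      case True
      then obtain i where i: "snd p $ i \<noteq> snd q $ i" using pq(3) by (metis prod_eqI vec_eq_iff)
      have b: "0 \<le> snd p $ i" "snd p $ i \<le> 1" "0 \<le> snd q $ i" "snd q $ i \<le> 1"
        using pq by (auto simp: mem_box_cart)
      have "cos (pi * snd p $ i) \<noteq> cos (pi * snd q $ i)"
      proof
        assume "cos (pi * snd p $ i) = cos (pi * snd q $ i)"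
        moreover have "0 \<le> pi * z \<and> pi * z \<le> pi" if "0 \<le> z" "z \<le> 1" for z
          using that by (simp add: mult_left_le)
        note this[OF b(1,2)] this[OF b(3,4)]
        ultimately have "pi * snd p $ i = pi * snd q $ i" using cos_inj_pi by presburger
        then show False using i by simp
      qed
      then show ?thesis by (intro bexI[OF _ cos[of i]])
    qed
  qed
  define C where "C = 2 powr (real CARD('n) / 2)"
  have "C > 0" by (simp add: C_def)
  have "continuous_on ({0..T} \<times> cbox 0 1) c" using assms(1) continuous_on_subset by blast
  then obtain q where q: "q \<in> R" "\<And>p. p \<in> {0..T} \<times> cbox 0 1 \<Longrightarrow> \<bar>c p - q p\<bar> < \<epsilon> / C"
    using R.Stone_Weierstrass_basic[of c "\<epsilon> / C"] \<open>\<epsilon> > 0\<close> \<open>C > 0\<close> by (meson divide_pos_pos)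
  have "modal_sum (\<lambda>p :: real \<times> (real ^ 'n). 1 * sine_mode (\<chi> i. 1) (snd p))"
    using modal_sum_single[of "\<lambda>t. 1" "\<chi> i. 1"] by (simp add: multi_indices_def)
  then have "modal_sum (\<lambda>p. q p * ground_mode (snd p))" using q(1) by (simp add: R_def ground_mode_def)
  moreover have "\<bar>c p * ground_mode (snd p) - q p * ground_mode (snd p)\<bar> < \<epsilon>"
    if "p \<in> {0..T} \<times> cbox 0 1" for p
  proof -
    have "\<bar>c p * ground_mode (snd p) - q p * ground_mode (snd p)\<bar> = \<bar>c p - q p\<bar> * \<bar>ground_mode (snd p)\<bar>"
      by (simp add: abs_mult flip: left_diff_distrib)
    also have "\<dots> \<le> \<bar>c p - q p\<bar> * C"
      unfolding ground_mode_def C_def by (intro mult_left_mono sine_mode_bound) auto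
    also have "\<dots> < \<epsilon>" using q(2)[OF that] \<open>C > 0\<close> by (simp add: pos_less_divide_eq)
    finally show ?thesis .
  qed
  ultimately show ?thesis by blast
qed

section \<open>Smooth functions and cut-offs on the cube\<close>

lemma C_k_Suc_imp: "C_k (Suc k) h \<Longrightarrow> C_k k h"
proof (induction k arbitrary: h)
  case 0
  then show ?case using differentiable_imp_continuous_on by auto
qed auto

lemma C_k_imp_continuous: "C_k k h \<Longrightarrow> continuous_on UNIV h"
  by (cases k) (auto intro: differentiable_imp_continuous_on)

lemma C_k_SucI:
  assumes "\<And>x. (h has_derivative h' x) (at x)" "\<And>b. b \<in> Basis \<Longrightarrow> C_k k (\<lambda>x. h' x b)"
  shows "C_k (Suc k) h"
proof -
  have "frechet_derivative h (at x) = h' x" for x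
    using frechet_derivative_at[OF assms(1)] by simp
  then show ?thesis using assms by (auto simp: differentiable_on_def differentiable_def)
qed

lemma C_k_SucD:
  assumes "C_k (Suc k) h"
  shows "(h has_derivative frechet_derivative h (at x)) (at x)"
    and "b \<in> Basis \<Longrightarrow> C_k k (\<lambda>x. frechet_derivative h (at x) b)"
  using assms by (auto simp: differentiable_on_def frechet_derivative_works[symmetric])

lemma C_k_const: "C_k k (\<lambda>x. c)"
proof (induction k arbitrary: c)
  case (Suc k)
  show ?case by (rule C_k_SucI[where h' = "\<lambda>x y. 0"]) (auto intro: Suc)
qed simp

lemma C_k_bounded_linear: "bounded_linear l \<Longrightarrow> C_k k l"
proof (cases k)
  case (Suc n)
  assume "bounded_linear l"
  then show ?thesis
    unfolding Suc by (intro C_k_SucI[where h' = "\<lambda>x. l"]) (auto intro: C_k_const bounded_linear_imp_has_derivative)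
qed (auto intro: linear_continuous_on)

lemma C_k_add: "C_k k f \<Longrightarrow> C_k k g \<Longrightarrow> C_k k (\<lambda>x. f x + g x)"
proof (induction k arbitrary: f g)
  case (Suc k)
  show ?case
    by (rule C_k_SucI[OF has_derivative_add[OF C_k_SucD(1)[OF Suc.prems(1)] C_k_SucD(1)[OF Suc.prems(2)]]])
      (intro Suc.IH C_k_SucD(2)[OF Suc.prems(1)] C_k_SucD(2)[OF Suc.prems(2)])
qed (auto intro: continuous_intros)

lemma C_k_mult: "C_k k f \<Longrightarrow> C_k k g \<Longrightarrow> C_k k (\<lambda>x. f x * g x)"
proof (induction k arbitrary: f g)
  case (Suc k)
  show ?case
    by (rule C_k_SucI[OF has_derivative_mult[OF C_k_SucD(1)[OF Suc.prems(1)] C_k_SucD(1)[OF Suc.prems(2)]]])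
      (intro Suc.IH C_k_add C_k_Suc_imp[OF Suc.prems(1)] C_k_Suc_imp[OF Suc.prems(2)]
        C_k_SucD(2)[OF Suc.prems(1)] C_k_SucD(2)[OF Suc.prems(2)])
qed (auto intro: continuous_intros)

lemma C_k_prod: "(\<And>i. i \<in> I \<Longrightarrow> C_k k (f i)) \<Longrightarrow> C_k k (\<lambda>x. \<Prod>i\<in>I. f i x)"
  by (induction I rule: infinite_finite_induct) (auto intro: C_k_mult C_k_const)

lemma C_k_real_polynomial_function: "real_polynomial_function p \<Longrightarrow> C_k k p"
  by (induction rule: real_polynomial_function.induct)
    (auto intro: C_k_bounded_linear C_k_const C_k_add C_k_mult)

text \<open>
  The functions \<open>p(1/s) e\<^sup>-\<^sup>1\<^sup>/\<^sup>s\<close>, extended by zero to \<open>s \<le> 0\<close>. Admitting all polynomials \<open>p\<close> makes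
  the family closed under differentiation, and so consist of smooth functions.
\<close>

definition flat :: "real poly \<Rightarrow> real \<Rightarrow> real" where
  "flat p s = (if s > 0 then poly p (1 / s) * exp (- (1 / s)) else 0)"

lemma poly_mult_exp_tendsto_0: "((\<lambda>y. poly p y * exp (- y)) \<longlongrightarrow> (0 :: real)) at_top"
proof -
  have "((\<lambda>y. \<Sum>i\<le>degree p. coeff p i * (y ^ i / exp y)) \<longlongrightarrow> (\<Sum>i\<le>degree p. coeff p i * 0)) at_top"
    by (intro tendsto_intros tendsto_power_div_exp_0)
  then show ?thesis by (simp add: poly_altdef exp_minus sum_distrib_right divide_inverse mult.assoc)
qed

lemma flat_derivative:
  "(flat p has_real_derivative flat ([:0, 0, 1:] * (p - pderiv p)) s) (at s)"
proof -
  consider "s > 0" | "s < 0" | "s = 0" by linarith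
  then show ?thesis
  proof cases
    case 1
    have "((\<lambda>s. poly p (1 / s) * exp (- (1 / s))) has_real_derivative
        poly (pderiv p) (1 / s) * (- (1 / s\<^sup>2)) * exp (- (1 / s))
          + exp (- (1 / s)) * (1 / s\<^sup>2) * poly p (1 / s)) (at s)"
      using 1 by (auto intro!: derivative_eq_intros DERIV_chain2[OF poly_DERIV] simp: power2_eq_square field_simps)
    then have "((\<lambda>s. poly p (1 / s) * exp (- (1 / s))) has_real_derivative
        flat ([:0, 0, 1:] * (p - pderiv p)) s) (at s)"
      by (rule DERIV_cong) (use 1 in \<open>simp add: flat_def power2_eq_square field_simps\<close>)
    then show ?thesis
      by (rule has_field_derivative_transform_within_open[where S = "{0<..}"]) (use 1 in \<open>auto simp: flat_def\<close>)
  next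
    case 2
    have "((\<lambda>s. 0) has_real_derivative flat ([:0, 0, 1:] * (p - pderiv p)) s) (at s)"
      using 2 by (simp add: flat_def)
    then show ?thesis
      by (rule has_field_derivative_transform_within_open[where S = "{..<0}"]) (use 2 in \<open>auto simp: flat_def\<close>)
  next
    case 3
    have "((\<lambda>h. poly (pCons 0 p) (inverse h) * exp (- inverse h)) \<longlongrightarrow> 0) (at_right 0)"
      by (rule filterlim_compose[OF poly_mult_exp_tendsto_0 filterlim_inverse_at_top_right])
    then have "((\<lambda>h. flat p h / h) \<longlongrightarrow> 0) (at_right 0)"
      by (rule tendsto_cong[THEN iffD1, rotated])
        (auto simp: flat_def eventually_at_right_less divide_inverse intro!: eventually_at_rightI[of 0 1])
    moreover have "((\<lambda>h. flat p h / h) \<longlongrightarrow> 0) (at_left 0)"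
      by (rule tendsto_eventually) (auto simp: flat_def intro!: eventually_at_leftI[of "-1"])
    ultimately have "((\<lambda>h. flat p h / h) \<longlongrightarrow> 0) (at 0)" by (rule filterlim_split_at[rotated])
    then show ?thesis using 3 by (simp add: has_field_derivative_iff flat_def)
  qed
qed

lemma C_k_flat_affine:
  assumes "bounded_linear l"
  shows "C_k k (\<lambda>x. flat p (l x + a))"
proof (induction k arbitrary: p)
  case 0
  have "continuous_on UNIV (flat p)"
    using DERIV_isCont[OF flat_derivative] by (simp add: continuous_at_imp_continuous_on)
  moreover have "continuous_on UNIV (\<lambda>x. l x + a)"
    by (intro continuous_intros linear_continuous_on assms)
  ultimately show ?case unfolding C_k.simps by (rule continuous_on_compose2) simp
next
  case (Suc k)
  let ?q = "[:0, 0, 1:] * (p - pderiv p)"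
  show ?case
  proof (rule C_k_SucI)
    fix x
    have "((\<lambda>x. l x + a) has_derivative l) (at x)"
      using has_derivative_add[OF bounded_linear_imp_has_derivative[OF assms] has_derivative_const[of a]] by simp
    from has_derivative_compose[OF this flat_derivative[unfolded has_field_derivative_def]]
    show "((\<lambda>x. flat p (l x + a)) has_derivative (\<lambda>y. flat ?q (l x + a) * l y)) (at x)" .
  next
    show "C_k k (\<lambda>x. flat ?q (l x + a) * l b)" for b by (intro C_k_mult Suc C_k_const)
  qed
qed

text \<open>
  A product of rescaled copies of \<open>e\<^sup>-\<^sup>1\<^sup>/\<^sup>s\<close>, for \<open>n > 0\<close> positive exactly where \<open>1/n < x\<^sub>i < 1 - 1/n\<close> for all \<open>i\<close>. As
  \<open>n \<rightarrow> \<infinity>\<close>, both the support exhausts the cube and the values tend to \<open>1\<close>, by the scaling of the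
  argument.
\<close>

definition cube_bump :: "nat \<Rightarrow> real ^ 'n::finite \<Rightarrow> real" where
  "cube_bump n x = (\<Prod>i\<in>UNIV. flat 1 (real n * x $ i + - 1) * flat 1 (- real n * x $ i + (real n - 1)))"

lemma cube_bump_smooth: "C_k k (cube_bump n)"
  unfolding cube_bump_def
  by (intro C_k_prod C_k_mult C_k_flat_affine bounded_linear_const_mult bounded_linear_vec_nth)

lemma cube_bump_support:
  assumes "n > 0" "cube_bump n x \<noteq> 0"
  shows "x \<in> cbox (\<chi> i. 1 / real n) (\<chi> i. 1 - 1 / real n)"
proof -
  have "real n * x $ i + - 1 > 0 \<and> - real n * x $ i + (real n - 1) > 0" for i
  proof -
    have "flat 1 (real n * x $ i + - 1) * flat 1 (- real n * x $ i + (real n - 1)) \<noteq> 0"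
      using assms(2) unfolding cube_bump_def by (simp add: prod_zero_iff)
    then show ?thesis by (auto simp: flat_def split: if_splits)
  qed
  then have "1 < real n * x $ i \<and> real n * x $ i < real n - 1" for i by (simp add: algebra_simps)
  then have "1 / real n \<le> x $ i \<and> x $ i \<le> 1 - 1 / real n" for i
    using assms(1) by (simp add: field_simps less_imp_le)
  then show ?thesis by (simp add: mem_box_cart)
qed

lemma cube_bump_mult_test_function:
  fixes p :: "real ^ 'n::finite \<Rightarrow> real"
  assumes "n > 0" "\<And>k. C_k k p"
  shows "(\<lambda>x. cube_bump n x * p x) \<in> test_functions unit_cube"
proof -
  let ?K = "cbox (\<chi> i. 1 / real n) (\<chi> i. 1 - 1 / real n) :: (real ^ 'n) set"
  have "?K \<subseteq> unit_cube"
  proof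
    fix x assume "x \<in> ?K"
    then have x: "1 / real n \<le> x $ i" "x $ i \<le> 1 - 1 / real n" for i by (auto simp: mem_box_cart)
    have "0 < 1 / real n" using assms by simp
    then show "x \<in> unit_cube" unfolding unit_cube_def using x by (smt (verit) mem_Collect_eq)
  qed
  moreover have "\<forall>x. x \<notin> ?K \<longrightarrow> cube_bump n x * p x = 0"
    using cube_bump_support[OF assms(1)] by (metis mult_zero_left)
  ultimately have "\<exists>K. compact K \<and> K \<subseteq> unit_cube \<and> (\<forall>x. x \<notin> K \<longrightarrow> cube_bump n x * p x = 0)"
    using compact_cbox[of "\<chi> i. 1 / real n" "\<chi> i. 1 - 1 / real n"] by (intro exI[of _ ?K] conjI)
  moreover have "\<forall>k. C_k k (\<lambda>x. cube_bump n x * p x)" by (intro allI C_k_mult cube_bump_smooth assms)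
  ultimately show ?thesis unfolding test_functions_def by (intro CollectI conjI)
qed

lemma flat_1_bounds: "0 \<le> flat 1 s" "flat 1 s \<le> 1"
  by (simp_all add: flat_def)

lemma cube_bump_bounds: "0 \<le> cube_bump n x" "cube_bump n x \<le> 1"
proof -
  have bounds: "0 \<le> flat 1 s * flat 1 t \<and> flat 1 s * flat 1 t \<le> 1" for s t
    by (intro conjI mult_nonneg_nonneg mult_le_one flat_1_bounds)
  show "0 \<le> cube_bump n x" unfolding cube_bump_def by (rule prod_nonneg) (simp only: bounds)
  show "cube_bump n x \<le> 1" unfolding cube_bump_def by (rule prod_le_1) (rule bounds)
qed

lemma flat_1_tendsto: "(flat 1 \<longlongrightarrow> 1) at_top"
proof -
  have "((\<lambda>s :: real. exp (- inverse s)) \<longlongrightarrow> exp (- 0)) at_top"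
    by (intro tendsto_intros tendsto_inverse_0_at_top filterlim_ident)
  moreover have "\<forall>\<^sub>F s :: real in at_top. exp (- inverse s) = flat 1 s"
    using eventually_gt_at_top[of 0] by eventually_elim (simp add: flat_def inverse_eq_divide)
  ultimately show ?thesis using tendsto_cong[of "\<lambda>s. exp (- inverse s)" "flat 1" at_top 1] by simp
qed

lemma cube_bump_tendsto:
  fixes x :: "real ^ 'n::finite"
  assumes "x \<in> unit_cube"
  shows "(\<lambda>n. cube_bump n x) \<longlonglongrightarrow> 1"
proof -
  have lim: "(\<lambda>n. flat 1 (real n * y + - 1)) \<longlonglongrightarrow> 1" if "y > 0" for y
  proof (rule filterlim_compose[OF flat_1_tendsto])
    have "filterlim (\<lambda>n. y * real n) at_top sequentially"
      by (rule filterlim_tendsto_pos_mult_at_top[OF tendsto_const that filterlim_real_sequentially])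
    then have "filterlim (\<lambda>n. - 1 + y * real n) at_top sequentially"
      by (rule filterlim_tendsto_add_at_top[OF tendsto_const])
    then show "filterlim (\<lambda>n. real n * y + - 1) at_top sequentially"
      by (simp only: mult.commute[of y] add.commute[of "- 1"])
  qed
  have eq: "- real n * x $ i + (real n - 1) = real n * (1 - x $ i) + - 1" for n i
    by (simp add: algebra_simps)
  have x: "x $ i > 0" "1 - x $ i > 0" for i using assms by (auto simp: unit_cube_def)
  have "(\<lambda>n. cube_bump n x) \<longlonglongrightarrow> (\<Prod>i\<in>(UNIV :: 'n set). 1 * 1)"
    unfolding cube_bump_def eq by (intro tendsto_prod tendsto_mult lim x)
  then show ?thesis by simp
qed

section \<open>The weak gradient of the zero function\<close>

lemma unit_cube_eq_box: "unit_cube = box 0 (1 :: real ^ 'n::finite)"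
  by (auto simp: unit_cube_def mem_box_cart)

lemma finite_measure_unit_cube: "finite_measure (lebesgue_on (unit_cube :: (real ^ 'n::finite) set))"
  unfolding unit_cube_eq_box by (intro finite_measure_lebesgue_on lmeasurable_box)

lemma unit_cube_lebesgue: "unit_cube \<in> sets (lebesgue :: (real ^ 'n::finite) measure)"
  unfolding unit_cube_eq_box by (rule fmeasurableD[OF lmeasurable_box])

definition truncated :: "real \<Rightarrow> real \<Rightarrow> real" where
  "truncated M y = max (- M) (min M y)"

lemma L2_space_integrable:
  assumes "v \<in> L2_space (unit_cube :: (real ^ 'n::finite) set)"
  shows "integrable (lebesgue_on unit_cube) v"
proof (rule Bochner_Integration.integrable_bound[where f = "\<lambda>x. 1 + (v x)\<^sup>2"])
  interpret finite_measure "lebesgue_on (unit_cube :: (real ^ 'n) set)" by (rule finite_measure_unit_cube)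
  show "integrable (lebesgue_on unit_cube) (\<lambda>x. 1 + (v x)\<^sup>2)"
    using assms by (auto simp: L2_space_def)
  show "v \<in> borel_measurable (lebesgue_on unit_cube)" using assms by (simp add: L2_space_def)
  have "\<bar>y\<bar> \<le> 1 + y\<^sup>2" for y :: real
    using zero_le_power2[of "\<bar>y\<bar> - 1"] by (simp add: power2_diff)
  then show "AE x in lebesgue_on unit_cube. norm (v x) \<le> norm (1 + (v x)\<^sup>2)"
    by (intro AE_I2) (metis abs_of_nonneg add_nonneg_nonneg real_norm_def zero_le_one zero_le_power2)
qed

text \<open>
  For a polynomial \<open>p\<close>, the functions \<open>cube_bump n * p\<close> are test functions converging boundedly to
  \<open>p\<close>, so \<open>v\<close> is orthogonal to all polynomials. Continuous functions are uniform limits of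
  polynomials on the closed cube.
\<close>

lemma integral_mult_continuous_zero:
  fixes v :: "real ^ 'n::finite \<Rightarrow> real"
  assumes v: "integrable (lebesgue_on unit_cube) v"
    and test: "\<And>\<phi>. \<phi> \<in> test_functions unit_cube \<Longrightarrow> integral\<^sup>L (lebesgue_on unit_cube) (\<lambda>x. v x * \<phi> x) = 0"
    and c: "continuous_on UNIV c"
  shows "integral\<^sup>L (lebesgue_on unit_cube) (\<lambda>x. v x * c x) = 0"
proof -
  let ?M = "lebesgue_on (unit_cube :: (real ^ 'n) set)"
  have meas: "h \<in> borel_measurable ?M" if "continuous_on UNIV h" for h :: "real ^ 'n \<Rightarrow> real"
    using that unit_cube_lebesgue continuous_imp_measurable_on_sets_lebesgue continuous_on_subset by blast
  have bdd: "\<exists>B. \<forall>x\<in>unit_cube. \<bar>h x\<bar> \<le> B" if "continuous_on UNIV h" for h :: "real ^ 'n \<Rightarrow> real"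
  proof -
    have "bounded (h ` cbox 0 1)"
      using that by (intro compact_imp_bounded compact_continuous_image) (auto intro: continuous_on_subset)
    then obtain B where B: "\<And>y. y \<in> h ` cbox 0 1 \<Longrightarrow> norm y \<le> B" by (auto simp: bounded_iff)
    have "unit_cube \<subseteq> cbox 0 (1 :: real ^ 'n)" unfolding unit_cube_eq_box by (rule box_subset_cbox)
    then show ?thesis using B by (intro exI[of _ B]) auto
  qed
  have int: "integrable ?M (\<lambda>x. v x * h x)" if h: "continuous_on UNIV h" for h
  proof -
    obtain B where B: "\<And>x. x \<in> unit_cube \<Longrightarrow> \<bar>h x\<bar> \<le> B" using bdd[OF h] by blast
    show ?thesis
    proof (rule Bochner_Integration.integrable_bound[of _ "\<lambda>x. B * v x"])
      show "integrable ?M (\<lambda>x. B * v x)" using v by simp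
      show "(\<lambda>x. v x * h x) \<in> borel_measurable ?M" using v meas[OF h] by measurable
      have "\<bar>v x * h x\<bar> \<le> \<bar>B * v x\<bar>" if "x \<in> unit_cube" for x
        unfolding abs_mult using mult_right_mono[OF B[OF that], of "\<bar>v x\<bar>"]
        by (smt (verit, best) abs_ge_zero abs_ge_self mult.commute mult_right_mono)
      then show "AE x in ?M. norm (v x * h x) \<le> norm (B * v x)" by (intro AE_I2) simp
    qed
  qed
  have poly: "integral\<^sup>L ?M (\<lambda>x. v x * p x) = 0" if p: "real_polynomial_function p" for p
  proof -
    have pc: "continuous_on UNIV p" using C_k_imp_continuous C_k_real_polynomial_function p by blast
    have bc: "continuous_on UNIV (\<lambda>x. cube_bump n x * p x)" for n
      using pc C_k_imp_continuous[OF cube_bump_smooth] by (intro continuous_intros)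
    have "(\<lambda>n. integral\<^sup>L ?M (\<lambda>x. v x * (cube_bump n x * p x))) \<longlonglongrightarrow> integral\<^sup>L ?M (\<lambda>x. v x * p x)"
    proof (rule integral_dominated_convergence[where w = "\<lambda>x. \<bar>v x * p x\<bar>"])
      show "(\<lambda>x. v x * p x) \<in> borel_measurable ?M" "integrable ?M (\<lambda>x. \<bar>v x * p x\<bar>)"
        using int[OF pc] by auto
      show "(\<lambda>x. v x * (cube_bump n x * p x)) \<in> borel_measurable ?M" for n
        using int[OF bc] by auto
      show "AE x in ?M. (\<lambda>n. v x * (cube_bump n x * p x)) \<longlonglongrightarrow> v x * p x"
      proof (rule AE_I2)
        fix x assume "x \<in> space ?M"
        then have "(\<lambda>n. v x * (cube_bump n x * p x)) \<longlonglongrightarrow> v x * (1 * p x)"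
          by (intro tendsto_intros cube_bump_tendsto) simp
        then show "(\<lambda>n. v x * (cube_bump n x * p x)) \<longlonglongrightarrow> v x * p x" by simp
      qed
      show "AE x in ?M. norm (v x * (cube_bump n x * p x)) \<le> \<bar>v x * p x\<bar>" for n
      proof (rule AE_I2)
        fix x
        have "\<bar>v x * (cube_bump n x * p x)\<bar> = cube_bump n x * \<bar>v x * p x\<bar>"
          using cube_bump_bounds[of n x] by (simp add: abs_mult)
        also have "\<dots> \<le> 1 * \<bar>v x * p x\<bar>" by (intro mult_right_mono cube_bump_bounds) auto
        finally show "norm (v x * (cube_bump n x * p x)) \<le> \<bar>v x * p x\<bar>" by simp
      qed
    qed
    moreover have "\<forall>\<^sub>F n in sequentially. integral\<^sup>L ?M (\<lambda>x. v x * (cube_bump n x * p x)) = 0"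
      using eventually_gt_at_top[of 0]
      by eventually_elim (intro test cube_bump_mult_test_function C_k_real_polynomial_function p)
    ultimately show ?thesis
      by (rule LIMSEQ_unique[OF _ tendsto_eventually])
  qed
  have "\<bar>integral\<^sup>L ?M (\<lambda>x. v x * c x)\<bar> \<le> e" if "e > 0" for e
  proof -
    define I where "I = integral\<^sup>L ?M (\<lambda>x. \<bar>v x\<bar>)"
    have "I \<ge> 0" by (simp add: I_def)
    have "e / (I + 1) > 0" using \<open>I \<ge> 0\<close> that by simp
    moreover have "continuous_on (cbox 0 1) c" using c continuous_on_subset by blast
    ultimately obtain p where p: "real_polynomial_function p" "\<And>x. x \<in> cbox 0 1 \<Longrightarrow> \<bar>c x - p x\<bar> < e / (I + 1)"
      using Stone_Weierstrass_real_polynomial_function[OF compact_cbox] by blast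
    have pc: "continuous_on UNIV p" using C_k_imp_continuous C_k_real_polynomial_function p by blast
    have "integral\<^sup>L ?M (\<lambda>x. v x * c x) = integral\<^sup>L ?M (\<lambda>x. v x * c x - v x * p x)"
      using int[OF c] int[OF pc] poly[OF p(1)] by simp
    also have "\<bar>\<dots>\<bar> \<le> integral\<^sup>L ?M (\<lambda>x. \<bar>v x * c x - v x * p x\<bar>)"
      by (rule integral_abs_bound)
    also have "\<dots> \<le> integral\<^sup>L ?M (\<lambda>x. e / (I + 1) * \<bar>v x\<bar>)"
    proof (rule integral_mono)
      show "integrable ?M (\<lambda>x. \<bar>v x * c x - v x * p x\<bar>)" using int[OF c] int[OF pc] by auto
      show "integrable ?M (\<lambda>x. e / (I + 1) * \<bar>v x\<bar>)" using v by auto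
      fix x assume "x \<in> space ?M"
      then have "x \<in> cbox 0 1" using box_subset_cbox by (auto simp: unit_cube_eq_box)
      then have "\<bar>c x - p x\<bar> * \<bar>v x\<bar> \<le> e / (I + 1) * \<bar>v x\<bar>" using p(2)[of x] by (intro mult_right_mono) auto
      then show "\<bar>v x * c x - v x * p x\<bar> \<le> e / (I + 1) * \<bar>v x\<bar>"
        by (simp only: abs_mult[symmetric] left_diff_distrib right_diff_distrib mult.commute[of _ "v x"])
    qed
    also have "\<dots> = e / (I + 1) * I" by (simp add: I_def)
    also have "\<dots> \<le> e" using \<open>I \<ge> 0\<close> that by (simp add: field_simps)
    finally show ?thesis .
  qed
  then have "\<bar>integral\<^sup>L ?M (\<lambda>x. v x * c x)\<bar> \<le> 0" by (rule field_le_epsilon) simp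
  then show ?thesis by simp
qed

lemma continuous_truncated [continuous_intros]:
  "continuous_on A h \<Longrightarrow> continuous_on A (\<lambda>x. truncated M (h x))"
  unfolding truncated_def by (intro continuous_intros)

lemma tendsto_truncated [tendsto_intros]: "(h \<longlongrightarrow> y) F \<Longrightarrow> ((\<lambda>n. truncated M (h n)) \<longlongrightarrow> truncated M y) F"
  unfolding truncated_def by (intro tendsto_intros)

lemma borel_measurable_truncated [measurable]: "truncated M \<in> borel_measurable borel"
  unfolding truncated_def[abs_def] by measurable

lemma truncated_bound: "0 \<le> M \<Longrightarrow> \<bar>truncated M y\<bar> \<le> M"
  by (auto simp: truncated_def)

text \<open>
  Carries statements that pass to dominated limits from continuous to measurable functions.
\<close>

lemma measurable_AE_limit_continuous:
  fixes v :: "'a::euclidean_space \<Rightarrow> real"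
  assumes "v \<in> borel_measurable (lebesgue_on S)" "S \<in> sets lebesgue"
  obtains g where "\<And>n. continuous_on UNIV (g n)" "AE x in lebesgue_on S. (\<lambda>n :: nat. g n x) \<longlonglongrightarrow> v x"
proof -
  have "v measurable_on S" using assms by (simp add: measurable_on_iff_borel_measurable)
  then obtain N g where N: "negligible N" and g: "\<And>n. continuous_on UNIV (g n)"
    and lim: "\<And>x. x \<notin> N \<Longrightarrow> (\<lambda>n :: nat. g n x) \<longlonglongrightarrow> (if x \<in> S then v x else 0)"
    unfolding measurable_on_def by blast
  have "AE x in lebesgue. x \<notin> N" using N by (simp add: negligible_iff_null_sets AE_not_in)
  then have "AE x in lebesgue_on S. (\<lambda>n. g n x) \<longlonglongrightarrow> v x"
    using assms(2) by (subst AE_restrict_space_iff) (auto elim!: eventually_mono dest!: lim split: if_splits)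
  then show ?thesis using that g by blast
qed

text \<open>
  If continuous functions converge to \<open>v\<close> almost everywhere, then their truncations to \<open>[-1, 1]\<close> are
  bounded, and dominated convergence shows that \<open>v\<close> is orthogonal to its own truncation. The
  integrand of that product is nonnegative and vanishes only where \<open>v\<close> does.
\<close>

lemma fundamental_lemma_unit_cube:
  fixes v :: "real ^ 'n::finite \<Rightarrow> real"
  assumes v: "v \<in> L2_space unit_cube"
    and test: "\<And>\<phi>. \<phi> \<in> test_functions unit_cube \<Longrightarrow> integral\<^sup>L (lebesgue_on unit_cube) (\<lambda>x. v x * \<phi> x) = 0"
  shows "AE x in lebesgue_on unit_cube. v x = 0"
proof -
  let ?M = "lebesgue_on (unit_cube :: (real ^ 'n) set)"
  have int: "integrable ?M v" by (rule L2_space_integrable[OF v])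
  have meas: "v \<in> borel_measurable ?M" using v by (simp add: L2_space_def)
  note sets = unit_cube_lebesgue
  obtain g where g: "\<And>n. continuous_on UNIV (g n)" "AE x in ?M. (\<lambda>n :: nat. g n x) \<longlonglongrightarrow> v x"
    using measurable_AE_limit_continuous[OF meas sets] by blast
  have bound: "\<bar>y * truncated 1 z\<bar> \<le> \<bar>y\<bar>" for y z
    unfolding abs_mult using truncated_bound[of 1 z] by (simp add: mult_left_le)
  have gm: "g n \<in> borel_measurable ?M" for n
    using g(1) sets continuous_imp_measurable_on_sets_lebesgue continuous_on_subset by blast
  have "(\<lambda>n. integral\<^sup>L ?M (\<lambda>x. v x * truncated 1 (g n x))) \<longlonglongrightarrow> integral\<^sup>L ?M (\<lambda>x. v x * truncated 1 (v x))"
  proof (rule integral_dominated_convergence[where w = "\<lambda>x. \<bar>v x\<bar>"])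
    show "(\<lambda>x. v x * truncated 1 (v x)) \<in> borel_measurable ?M" using meas by measurable
    show "(\<lambda>x. v x * truncated 1 (g n x)) \<in> borel_measurable ?M" for n using meas gm[of n] by measurable
    show "integrable ?M (\<lambda>x. \<bar>v x\<bar>)" using int by simp
    show "AE x in ?M. (\<lambda>n. v x * truncated 1 (g n x)) \<longlonglongrightarrow> v x * truncated 1 (v x)"
      using g(2) by eventually_elim (intro tendsto_intros)
    show "AE x in ?M. norm (v x * truncated 1 (g n x)) \<le> \<bar>v x\<bar>" for n by (intro AE_I2) (simp add: bound)
  qed
  moreover have "integral\<^sup>L ?M (\<lambda>x. v x * truncated 1 (g n x)) = 0" for n
    using integral_mult_continuous_zero[OF int test continuous_truncated[OF g(1)]] by blast
  ultimately have zero: "integral\<^sup>L ?M (\<lambda>x. v x * truncated 1 (v x)) = 0"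
    by (simp add: LIMSEQ_const_iff)
  have nonneg: "0 \<le> y * truncated 1 y" for y by (auto simp: truncated_def zero_le_mult_iff)
  have "integrable ?M (\<lambda>x. v x * truncated 1 (v x))"
    by (rule Bochner_Integration.integrable_bound[OF int]) (use meas bound in auto)
  then have "AE x in ?M. v x * truncated 1 (v x) = 0"
    using integral_nonneg_eq_0_iff_AE[of ?M "\<lambda>x. v x * truncated 1 (v x)"] nonneg zero by simp
  moreover have "y = 0" if "y * truncated 1 y = 0" for y
    using that by (auto simp: truncated_def max_def min_def split: if_splits)
  ultimately show ?thesis by (rule eventually_mono)
qed

lemma zero_L2_space: "(\<lambda>x. 0) \<in> L2_space S"
  by (simp add: L2_space_def)

lemma is_weak_partial_zero: "is_weak_partial S i (\<lambda>x. 0) (\<lambda>x. 0)"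
  by (simp add: is_weak_partial_def zero_L2_space)

text \<open>
  Weak partial derivatives are obtained by choice; every choice for the zero function is
  orthogonal to all test functions.
\<close>

lemma weak_grad_zero:
  "AE x in lebesgue_on unit_cube. weak_grad unit_cube (\<lambda>x. 0) x = (0 :: real ^ 'n::finite)"
proof -
  have "AE x in lebesgue_on unit_cube. weak_partial unit_cube i (\<lambda>x :: real ^ 'n. 0) x = 0" for i
  proof (rule fundamental_lemma_unit_cube)
    have "is_weak_partial unit_cube i (\<lambda>x :: real ^ 'n. 0) (weak_partial unit_cube i (\<lambda>x. 0))"
      unfolding weak_partial_def by (rule someI[of _ "\<lambda>x. 0"]) (rule is_weak_partial_zero)
    then show "weak_partial unit_cube i (\<lambda>x :: real ^ 'n. 0) \<in> L2_space unit_cube"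
      "\<phi> \<in> test_functions unit_cube \<Longrightarrow>
        integral\<^sup>L (lebesgue_on unit_cube) (\<lambda>x. weak_partial unit_cube i (\<lambda>x. 0) x * \<phi> x) = 0" for \<phi>
      by (auto simp: is_weak_partial_def)
  qed
  then have "AE x in lebesgue_on unit_cube. \<forall>i. weak_partial unit_cube i (\<lambda>x :: real ^ 'n. 0) x = 0"
    by (simp add: AE_all_countable)
  then show ?thesis by eventually_elim (simp add: weak_grad_def vec_eq_iff)
qed

lemma zero_H1_0: "(\<lambda>x. 0) \<in> H1_0 (unit_cube :: (real ^ 'n::finite) set)"
proof -
  have norm: "H1_norm unit_cube (\<lambda>x :: real ^ 'n. 0) = 0"
  proof -
    have "integral\<^sup>L (lebesgue_on unit_cube) (\<lambda>x :: real ^ 'n. (norm (weak_grad unit_cube (\<lambda>x. 0) x))\<^sup>2) = 0"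
      by (rule integral_eq_zero_AE) (use weak_grad_zero in eventually_elim, simp)
    then show ?thesis by (simp add: H1_norm_def L2_norm_def)
  qed
  have "(\<lambda>x :: real ^ 'n. 0) \<in> test_functions unit_cube"
    by (auto simp: test_functions_def C_k_const intro: exI[of _ "{}"])
  then show ?thesis
    using norm is_weak_partial_zero
    by (auto simp: H1_0_def H1_def zero_L2_space intro!: bexI[of _ "\<lambda>x. 0"] simp: fun_diff_def)
qed

section \<open>Density in the square-integrable functions on the space-time cylinder\<close>

text \<open>
  A triangle inequality for squared distances, from \<open>(a + b)\<^sup>2 \<le> 2 a\<^sup>2 + 2 b\<^sup>2\<close>.
\<close>

lemma L2_diff_triangle:
  assumes fg: "(\<lambda>x. f x - g x) \<in> L2_space S" and gh: "(\<lambda>x. g x - h x) \<in> L2_space S"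
  shows "(\<lambda>x. f x - h x) \<in> L2_space S"
    and "integral\<^sup>L (lebesgue_on S) (\<lambda>x. (f x - h x)\<^sup>2)
      \<le> 2 * integral\<^sup>L (lebesgue_on S) (\<lambda>x. (f x - g x)\<^sup>2)
        + 2 * integral\<^sup>L (lebesgue_on S) (\<lambda>x. (g x - h x)\<^sup>2)"
proof -
  let ?M = "lebesgue_on S"
  have meas: "(\<lambda>x. f x - h x) \<in> borel_measurable ?M"
    using borel_measurable_add[of "\<lambda>x. f x - g x" ?M "\<lambda>x. g x - h x"] fg gh by (simp add: L2_space_def)
  have ineq: "(f x - h x)\<^sup>2 \<le> 2 * (f x - g x)\<^sup>2 + 2 * (g x - h x)\<^sup>2" for x
  proof -
    have "0 \<le> ((f x - g x) - (g x - h x))\<^sup>2" by simp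
    then show ?thesis by (simp add: power2_eq_square algebra_simps)
  qed
  have bound: "integrable ?M (\<lambda>x. 2 * (f x - g x)\<^sup>2 + 2 * (g x - h x)\<^sup>2)"
    using fg gh by (simp add: L2_space_def)
  have int: "integrable ?M (\<lambda>x. (f x - h x)\<^sup>2)"
    by (rule Bochner_Integration.integrable_bound[OF bound]) (use meas ineq in \<open>auto intro!: AE_I2\<close>)
  show "(\<lambda>x. f x - h x) \<in> L2_space S" using meas int by (simp add: L2_space_def)
  have "integral\<^sup>L ?M (\<lambda>x. (f x - h x)\<^sup>2) \<le> integral\<^sup>L ?M (\<lambda>x. 2 * (f x - g x)\<^sup>2 + 2 * (g x - h x)\<^sup>2)"
    by (rule integral_mono[OF int bound ineq])
  also have "\<dots> = 2 * integral\<^sup>L ?M (\<lambda>x. (f x - g x)\<^sup>2) + 2 * integral\<^sup>L ?M (\<lambda>x. (g x - h x)\<^sup>2)"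
    using fg gh by (simp add: L2_space_def)
  finally show "integral\<^sup>L ?M (\<lambda>x. (f x - h x)\<^sup>2)
      \<le> 2 * integral\<^sup>L ?M (\<lambda>x. (f x - g x)\<^sup>2) + 2 * integral\<^sup>L ?M (\<lambda>x. (g x - h x)\<^sup>2)" .
qed

lemma L2_spaceI_bounded:
  assumes "finite_measure (lebesgue_on S)" "h \<in> borel_measurable (lebesgue_on S)"
    and B: "\<And>x. x \<in> S \<Longrightarrow> \<bar>h x\<bar> \<le> B"
  shows "h \<in> L2_space S" and "integral\<^sup>L (lebesgue_on S) (\<lambda>x. (h x)\<^sup>2) \<le> B\<^sup>2 * measure (lebesgue_on S) S"
proof -
  interpret finite_measure "lebesgue_on S" by fact
  have bound: "(h x)\<^sup>2 \<le> B\<^sup>2" if "x \<in> S" for x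
    using power_mono[OF B[OF that], of 2] by simp
  have int: "integrable (lebesgue_on S) (\<lambda>x. (h x)\<^sup>2)"
    by (rule Bochner_Integration.integrable_bound[of _ "\<lambda>x. B\<^sup>2"]) (use assms bound in \<open>auto intro!: AE_I2\<close>)
  then show "h \<in> L2_space S" using assms by (simp add: L2_space_def)
  have "integral\<^sup>L (lebesgue_on S) (\<lambda>x. (h x)\<^sup>2) \<le> integral\<^sup>L (lebesgue_on S) (\<lambda>x. B\<^sup>2)"
    by (rule integral_mono[OF int]) (use bound in auto)
  also have "\<dots> = B\<^sup>2 * measure (lebesgue_on S) S" by simp
  finally show "integral\<^sup>L (lebesgue_on S) (\<lambda>x. (h x)\<^sup>2) \<le> B\<^sup>2 * measure (lebesgue_on S) S" .
qed

definition cylinder :: "real \<Rightarrow> (real \<times> (real ^ 'n::finite)) set" where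
  "cylinder T = {0<..<T} \<times> unit_cube"

lemma cylinder_eq_box: "cylinder T = box (0, 0) (T, 1 :: real ^ 'n::finite)"
  by (auto simp: cylinder_def unit_cube_eq_box box_def Basis_prod_def)

lemma cylinder_lmeasurable: "cylinder T \<in> lmeasurable"
  unfolding cylinder_eq_box by (rule lmeasurable_box)

lemma cylinder_lebesgue: "cylinder T \<in> sets lebesgue"
  by (rule fmeasurableD[OF cylinder_lmeasurable])

lemma cylinder_closure: "p \<in> cylinder T \<Longrightarrow> p \<in> {0..T} \<times> cbox 0 1"
  unfolding cylinder_def unit_cube_eq_box using box_subset_cbox by fastforce

lemma continuous_measurable_on_cylinder:
  "continuous_on UNIV h \<Longrightarrow> (h :: _ \<Rightarrow> real) \<in> borel_measurable (lebesgue_on (cylinder T))"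
  using cylinder_lebesgue continuous_imp_measurable_on_sets_lebesgue continuous_on_subset by blast

text \<open>
  Divide \<open>F\<close> by the ground mode \<open>e\<close>, which is positive on the cylinder. The quotient need not be
  integrable, but truncating it at \<open>\<plusminus>m\<close> and multiplying by \<open>e\<close> again gives functions that
  differ from \<open>F\<close> by at most \<open>\<bar>F\<bar>\<close>, so they converge to \<open>F\<close> by dominated convergence. The truncated
  quotient is a bounded limit of continuous functions, and products of continuous functions with \<open>e\<close>
  are uniform limits of modal sums.
\<close>

lemma modal_sum_dense:
  fixes F :: "real \<times> (real ^ 'n::finite) \<Rightarrow> real"
  assumes F: "F \<in> L2_space (cylinder T)" and "\<epsilon> > 0"
  shows "\<exists>u. modal_sum u \<and> (\<lambda>p. F p - u p) \<in> L2_space (cylinder T) \<and>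
    integral\<^sup>L (lebesgue_on (cylinder T)) (\<lambda>p. (F p - u p)\<^sup>2) < \<epsilon>"
proof -
  let ?M = "lebesgue_on (cylinder T :: (real \<times> (real ^ 'n)) set)"
  let ?S = "\<lambda>p :: real \<times> (real ^ 'n). ground_mode (snd p)"
  interpret finite_measure ?M by (rule finite_measure_lebesgue_on[OF cylinder_lmeasurable])
  have Fm [measurable]: "F \<in> borel_measurable ?M" and F2: "integrable ?M (\<lambda>p. (F p)\<^sup>2)"
    using F by (auto simp: L2_space_def)
  have Sc: "continuous_on UNIV ?S" unfolding ground_mode_def by (intro continuous_intros)
  have Sm [measurable]: "?S \<in> borel_measurable ?M" by (rule continuous_measurable_on_cylinder[OF Sc])
  define Q where "Q p = F p / ?S p" for p
  have Qm [measurable]: "Q \<in> borel_measurable ?M" unfolding Q_def by measurable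
  have S_pos: "?S p > 0" if "p \<in> cylinder T" for p
    using that by (intro ground_mode_pos) (auto simp: cylinder_def)
  have FQ: "F p = Q p * ?S p" if "p \<in> cylinder T" for p
    using S_pos[OF that] by (simp add: Q_def)
  define C where "C = 2 powr (real CARD('n) / 2)"
  have "C > 0" by (simp add: C_def)
  have S_bound: "\<bar>?S p\<bar> \<le> C" for p unfolding C_def ground_mode_def by (rule sine_mode_bound)
  \<comment> \<open>three errors of size \<open>e\<close> combine to less than \<open>2e + 2(2e + 2e) = 10e\<close>\<close>
  define e where "e = \<epsilon> / 10"
  have "e > 0" using \<open>\<epsilon> > 0\<close> by (simp add: e_def)

  have "(\<lambda>m. integral\<^sup>L ?M (\<lambda>p. (F p - truncated (real m) (Q p) * ?S p)\<^sup>2)) \<longlonglongrightarrow> integral\<^sup>L ?M (\<lambda>p. 0)"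
  proof (rule integral_dominated_convergence[where w = "\<lambda>p. (F p)\<^sup>2"])
    show "AE p in ?M. (\<lambda>m. (F p - truncated (real m) (Q p) * ?S p)\<^sup>2) \<longlonglongrightarrow> 0"
    proof (rule AE_I2)
      fix p assume "p \<in> space ?M"
      then have p: "p \<in> cylinder T" by simp
      have "\<forall>\<^sub>F m in sequentially. \<bar>Q p\<bar> \<le> real m"
        using filterlim_real_sequentially by (auto simp: filterlim_at_top)
      then have "\<forall>\<^sub>F m in sequentially. (F p - truncated (real m) (Q p) * ?S p)\<^sup>2 = 0"
        by eventually_elim (auto simp: truncated_def FQ[OF p])
      then show "(\<lambda>m. (F p - truncated (real m) (Q p) * ?S p)\<^sup>2) \<longlonglongrightarrow> 0" by (rule tendsto_eventually)
    qed
    show "AE p in ?M. norm ((F p - truncated (real m) (Q p) * ?S p)\<^sup>2) \<le> (F p)\<^sup>2" for m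
    proof (rule AE_I2)
      fix p assume "p \<in> space ?M"
      then have p: "p \<in> cylinder T" by simp
      have "\<bar>F p - truncated (real m) (Q p) * ?S p\<bar> = \<bar>Q p - truncated (real m) (Q p)\<bar> * ?S p"
        using S_pos[OF p] FQ[OF p] by (simp add: abs_mult flip: left_diff_distrib)
      also have "\<dots> \<le> \<bar>Q p\<bar> * ?S p"
        using S_pos[OF p] by (intro mult_right_mono) (auto simp: truncated_def)
      also have "\<dots> = \<bar>F p\<bar>" using S_pos[OF p] FQ[OF p] by (simp add: abs_mult)
      finally show "norm ((F p - truncated (real m) (Q p) * ?S p)\<^sup>2) \<le> (F p)\<^sup>2"
        by (simp add: abs_le_square_iff)
    qed
  qed (use F2 in measurable)
  then have "\<forall>\<^sub>F m in sequentially. integral\<^sup>L ?M (\<lambda>p. (F p - truncated (real m) (Q p) * ?S p)\<^sup>2) < e"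
    using \<open>e > 0\<close> by (intro order_tendstoD(2)) auto
  then obtain m :: nat where m: "integral\<^sup>L ?M (\<lambda>p. (F p - truncated (real m) (Q p) * ?S p)\<^sup>2) < e"
    by (auto simp: eventually_sequentially)

  obtain g where g: "\<And>n. continuous_on UNIV (g n)" "AE p in ?M. (\<lambda>n :: nat. g n p) \<longlonglongrightarrow> Q p"
    using measurable_AE_limit_continuous[OF Qm cylinder_lebesgue] by blast
  have gm [measurable]: "g n \<in> borel_measurable ?M" for n by (rule continuous_measurable_on_cylinder[OF g(1)])
  have diff_bound: "\<bar>truncated (real m) y * ?S p - truncated (real m) z * ?S p\<bar> \<le> 2 * real m * C" for y z p
  proof -
    have "\<bar>truncated (real m) y * ?S p - truncated (real m) z * ?S p\<bar>
        = \<bar>truncated (real m) y - truncated (real m) z\<bar> * \<bar>?S p\<bar>"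
      by (simp add: abs_mult flip: left_diff_distrib)
    also have "\<dots> \<le> (2 * real m) * C"
      using truncated_bound[of "real m" y] truncated_bound[of "real m" z] S_bound[of p]
      by (intro mult_mono) auto
    finally show ?thesis .
  qed
  have "(\<lambda>n. integral\<^sup>L ?M (\<lambda>p. (truncated (real m) (Q p) * ?S p - truncated (real m) (g n p) * ?S p)\<^sup>2))
      \<longlonglongrightarrow> integral\<^sup>L ?M (\<lambda>p. 0)"
  proof (rule integral_dominated_convergence[where w = "\<lambda>p. (2 * real m * C)\<^sup>2"])
    show "AE p in ?M. (\<lambda>n. (truncated (real m) (Q p) * ?S p - truncated (real m) (g n p) * ?S p)\<^sup>2) \<longlonglongrightarrow> 0"
      using g(2)
    proof eventually_elim
      case (elim p)
      have "(\<lambda>n. (truncated (real m) (Q p) * ?S p - truncated (real m) (g n p) * ?S p)\<^sup>2)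
        \<longlonglongrightarrow> (truncated (real m) (Q p) * ?S p - truncated (real m) (Q p) * ?S p)\<^sup>2"
        by (intro tendsto_intros elim)
      then show ?case by simp
    qed
    show "AE p in ?M. norm ((truncated (real m) (Q p) * ?S p - truncated (real m) (g n p) * ?S p)\<^sup>2)
        \<le> (2 * real m * C)\<^sup>2" for n
    proof (rule AE_I2)
      fix p
      show "norm ((truncated (real m) (Q p) * ?S p - truncated (real m) (g n p) * ?S p)\<^sup>2) \<le> (2 * real m * C)\<^sup>2"
        using power_mono[OF diff_bound[of "Q p" p "g n p"] abs_ge_zero, of 2] by simp
    qed
  qed (simp_all, measurable)
  then have "\<forall>\<^sub>F n in sequentially.
      integral\<^sup>L ?M (\<lambda>p. (truncated (real m) (Q p) * ?S p - truncated (real m) (g n p) * ?S p)\<^sup>2) < e"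
    using \<open>e > 0\<close> by (intro order_tendstoD(2)) auto
  then obtain n :: nat where
    n: "integral\<^sup>L ?M (\<lambda>p. (truncated (real m) (Q p) * ?S p - truncated (real m) (g n p) * ?S p)\<^sup>2) < e"
    by (auto simp: eventually_sequentially)

  define \<mu> where "\<mu> = measure ?M (cylinder T)"
  have "\<mu> \<ge> 0" by (simp add: \<mu>_def)
  define \<delta> where "\<delta> = sqrt (e / (\<mu> + 1))"
  have "\<delta> > 0" using \<open>e > 0\<close> \<open>\<mu> \<ge> 0\<close> by (simp add: \<delta>_def)
  have "continuous_on UNIV (\<lambda>p. truncated (real m) (g n p))" by (intro continuous_intros g)
  from ground_mode_mult_dense[OF this \<open>\<delta> > 0\<close>, of T]
  obtain u where u: "modal_sum u"
    "\<And>p. p \<in> {0..T} \<times> cbox 0 1 \<Longrightarrow> \<bar>truncated (real m) (g n p) * ?S p - u p\<bar> < \<delta>" by auto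
  have um [measurable]: "u \<in> borel_measurable ?M"
    by (rule continuous_measurable_on_cylinder[OF modal_sum_continuous[OF u(1)]])
  have "\<bar>truncated (real m) (g n p) * ?S p - u p\<bar> \<le> \<delta>" if "p \<in> cylinder T" for p
    using u(2)[OF cylinder_closure[OF that]] by simp
  note c = L2_spaceI_bounded[OF finite_measure_axioms _ this]
  have c1: "(\<lambda>p. truncated (real m) (g n p) * ?S p - u p) \<in> L2_space (cylinder T)"
    by (rule c(1)) measurable
  have "integral\<^sup>L ?M (\<lambda>p. (truncated (real m) (g n p) * ?S p - u p)\<^sup>2) \<le> \<delta>\<^sup>2 * \<mu>"
    unfolding \<mu>_def by (rule c(2)) measurable
  also have "\<dots> = e / (\<mu> + 1) * \<mu>" using \<open>e > 0\<close> \<open>\<mu> \<ge> 0\<close> by (simp add: \<delta>_def)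
  also have "\<dots> \<le> e" using \<open>e > 0\<close> \<open>\<mu> \<ge> 0\<close> by (simp add: field_simps)
  finally have c2: "integral\<^sup>L ?M (\<lambda>p. (truncated (real m) (g n p) * ?S p - u p)\<^sup>2) \<le> e" .
  have b1: "(\<lambda>p. truncated (real m) (Q p) * ?S p - truncated (real m) (g n p) * ?S p) \<in> L2_space (cylinder T)"
    by (rule L2_spaceI_bounded(1)[OF finite_measure_axioms _ diff_bound]) measurable
  have T1: "(\<lambda>p. truncated (real m) (Q p) * ?S p) \<in> L2_space (cylinder T)"
  proof (rule L2_spaceI_bounded(1)[OF finite_measure_axioms])
    show "\<bar>truncated (real m) (Q p) * ?S p\<bar> \<le> real m * C" for p
      unfolding abs_mult using truncated_bound[of "real m" "Q p"] S_bound[of p] by (intro mult_mono) auto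
  qed measurable
  have a1: "(\<lambda>p. F p - truncated (real m) (Q p) * ?S p) \<in> L2_space (cylinder T)"
  proof -
    have "(\<lambda>p. F p - 0) \<in> L2_space (cylinder T)" using F by simp
    moreover have "(\<lambda>p. 0 - truncated (real m) (Q p) * ?S p) \<in> L2_space (cylinder T)"
      using T1 by (simp add: L2_space_def)
    ultimately show ?thesis by (rule L2_diff_triangle(1))
  qed
  note bc = L2_diff_triangle[OF b1 c1]
  note abc = L2_diff_triangle[OF a1 bc(1)]
  have "integral\<^sup>L ?M (\<lambda>p. (F p - u p)\<^sup>2) < \<epsilon>"
    using abc(2) bc(2) c2 n m \<open>e > 0\<close> by (simp add: e_def)
  then show ?thesis using u(1) abc(1) by blast
qed

section \<open>Replacing the coefficients by networks\<close>

text \<open>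
  Each coefficient is replaced by a network. A mode that is added may already occur in the sum, in
  which case its networks are added.
\<close>

lemma modal_sum_network:
  fixes u :: "real \<times> (real ^ 'n::{finite,linorder}) \<Rightarrow> real"
  assumes \<sigma>: "continuous_on UNIV \<sigma>" "\<nexists>p :: real poly. \<sigma> = poly p"
    and u: "modal_sum u"
  shows "\<epsilon> > 0 \<Longrightarrow> \<exists>P N. (\<forall>j. N j \<in> networks \<sigma>) \<and>
    (\<forall>t x. \<bar>t\<bar> \<le> T \<longrightarrow> \<bar>u (t, x) - (\<Sum>j=1..P. N j t * eigenfunction j x)\<bar> < \<epsilon>)"
  using u
proof (induction arbitrary: \<epsilon>)
  case modal_sum_zero
  then show ?case using networks_zero by (intro exI[of _ "0::nat"] exI[of _ "\<lambda>j t. 0"]) auto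
next
  case (modal_sum_insert u a k)
  define C where "C = 2 powr (real CARD('n) / 2)"
  have "C > 0" by (simp add: C_def)
  obtain P N where N: "\<And>j. N j \<in> networks \<sigma>"
    "\<And>t x. \<bar>t\<bar> \<le> T \<Longrightarrow> \<bar>u (t, x) - (\<Sum>j=1..P. N j t * eigenfunction j x)\<bar> < \<epsilon> / 2"
    using modal_sum_insert.IH[of "\<epsilon> / 2"] half_gt_zero[OF \<open>\<epsilon> > 0\<close>] by blast
  have "\<epsilon> / (2 * C) > 0" using \<open>\<epsilon> > 0\<close> \<open>C > 0\<close> by simp
  then obtain A where A: "A \<in> networks \<sigma>" "\<And>t. \<bar>t\<bar> \<le> T \<Longrightarrow> \<bar>a t - A t\<bar> < \<epsilon> / (2 * C)"
    using network_limit_continuous[OF \<sigma> modal_sum_insert.hyps(2)] unfolding network_limit_def by meson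
  define q where "q = mode_position k"
  have q: "1 \<le> q" by (simp add: q_def mode_position_def)
  have k: "sine_mode k = eigenfunction q"
    using modal_sum_insert.hyps(3) by (simp add: eigenfunction_def q_def mode_index_position)
  define N' where "N' j = (\<lambda>t. (if j \<le> P then N j t else 0) + (if j = q then A t else 0))" for j
  have N': "N' j \<in> networks \<sigma>" for j
    unfolding N'_def using N(1) A(1) networks_zero by (intro networks_add) (cases "j \<le> P"; cases "j = q"; simp)+
  have "\<bar>u (t, x) + a t * sine_mode k x - (\<Sum>j=1..max P q. N' j t * eigenfunction j x)\<bar> < \<epsilon>"
    if t: "\<bar>t\<bar> \<le> T" for t x
  proof -
    have "(\<Sum>j=1..max P q. N' j t * eigenfunction j x)
        = (\<Sum>j=1..max P q. (if j \<le> P then N j t * eigenfunction j x else 0))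
          + (\<Sum>j=1..max P q. (if j = q then A t * eigenfunction j x else 0))"
      by (simp only: sum.distrib[symmetric]) (intro sum.cong, auto simp: N'_def distrib_right)
    also have "(\<Sum>j=1..max P q. (if j \<le> P then N j t * eigenfunction j x else 0))
        = (\<Sum>j=1..P. N j t * eigenfunction j x)"
      by (intro sum.mono_neutral_cong_right) auto
    also have "(\<Sum>j=1..max P q. (if j = q then A t * eigenfunction j x else 0)) = A t * sine_mode k x"
      using q by (simp add: k)
    finally have "\<bar>u (t, x) + a t * sine_mode k x - (\<Sum>j=1..max P q. N' j t * eigenfunction j x)\<bar>
        = \<bar>(u (t, x) - (\<Sum>j=1..P. N j t * eigenfunction j x)) + (a t - A t) * sine_mode k x\<bar>"
      by (simp add: algebra_simps)
    also have "\<dots> \<le> \<bar>u (t, x) - (\<Sum>j=1..P. N j t * eigenfunction j x)\<bar> + \<bar>(a t - A t) * sine_mode k x\<bar>"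
      by (rule abs_triangle_ineq)
    also have "\<bar>(a t - A t) * sine_mode k x\<bar> \<le> \<epsilon> / (2 * C) * C"
      unfolding abs_mult using A(2)[OF t] sine_mode_bound[of k x] \<open>\<epsilon> > 0\<close> \<open>C > 0\<close>
      by (intro mult_mono) (auto simp: C_def)
    also have "\<epsilon> / (2 * C) * C = \<epsilon> / 2" using \<open>C > 0\<close> by simp
    finally show ?thesis using N(2)[OF t, of x] by simp
  qed
  then show ?case using N' by (intro exI[of _ "max P q"] exI[of _ N']) simp
qed

lemma networks_continuous:
  assumes "continuous_on UNIV \<sigma>" "N \<in> networks \<sigma>"
  shows "continuous_on UNIV N"
proof -
  obtain m a w b where "N = (\<lambda>s. \<Sum>i<(m::nat). a i * \<sigma> (w i * s + b i))"
    using assms(2) by (auto simp: networks_def)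
  then show ?thesis by (auto intro!: continuous_intros continuous_on_compose2[OF assms(1)])
qed

lemma common_width:
  assumes "\<And>j. N j \<in> networks \<sigma>"
  shows "\<exists>m\<ge>1. \<exists>A W B. \<forall>j\<in>{1..P::nat}. N j = (\<lambda>t. \<Sum>i<(m::nat). A j i * \<sigma> (W j i * t + B j i))"
proof -
  have "\<exists>m a w b. \<forall>n\<ge>m. N j = (\<lambda>s. \<Sum>i<(n::nat). a i * \<sigma> (w i * s + b i))" for j
    using networks_padded_width[OF assms[of j]] by metis
  then obtain m A W B where
    N: "\<And>j n. n \<ge> m j \<Longrightarrow> N j = (\<lambda>s. \<Sum>i<(n::nat). A j i * \<sigma> (W j i * s + B j i))"
    by metis
  define M where "M = Max (insert 1 (m ` {1..P}))"
  have "1 \<le> M" "\<forall>j\<in>{1..P}. m j \<le> M"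
    unfolding M_def by (intro Max_ge ballI; simp)+
  then show ?thesis using N by (intro exI[of _ M] conjI exI[of _ A] exI[of _ W] exI[of _ B]) auto
qed

lemma eigenfunction_network_dense:
  fixes F :: "real \<times> (real ^ 'n::{finite,linorder}) \<Rightarrow> real"
  assumes \<sigma>: "continuous_on UNIV \<sigma>" "\<nexists>p :: real poly. \<sigma> = poly p"
    and F: "F \<in> L2_space (cylinder T)" and "\<epsilon> > 0"
  obtains P m and A W B :: "nat \<Rightarrow> nat \<Rightarrow> real" and G where "P \<ge> 1" "m \<ge> 1"
    "G = (\<lambda>(t, x). \<Sum>j=1..P. (\<Sum>i<m. A j i * \<sigma> (W j i * t + B j i)) * eigenfunction j x)"
    "(\<lambda>p. F p - G p) \<in> L2_space (cylinder T)"
    "integral\<^sup>L (lebesgue_on (cylinder T)) (\<lambda>p. (F p - G p)\<^sup>2) < \<epsilon>"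
proof -
  let ?M = "lebesgue_on (cylinder T :: (real \<times> (real ^ 'n::{finite,linorder})) set)"
  interpret finite_measure ?M by (rule finite_measure_lebesgue_on[OF cylinder_lmeasurable])
  obtain u where u: "modal_sum u" "(\<lambda>p. F p - u p) \<in> L2_space (cylinder T)"
    "integral\<^sup>L ?M (\<lambda>p. (F p - u p)\<^sup>2) < \<epsilon> / 4"
    using modal_sum_dense[OF F, of "\<epsilon> / 4"] \<open>\<epsilon> > 0\<close> by auto
  define \<mu> where "\<mu> = measure ?M (cylinder T)"
  have "\<mu> \<ge> 0" by (simp add: \<mu>_def)
  define \<delta> where "\<delta> = sqrt (\<epsilon> / 4 / (\<mu> + 1))"
  have "\<delta> > 0" using \<open>\<epsilon> > 0\<close> \<open>\<mu> \<ge> 0\<close> by (simp add: \<delta>_def)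
  obtain P N where N: "\<And>j. N j \<in> networks \<sigma>"
    "\<And>t x. \<bar>t\<bar> \<le> T \<Longrightarrow> \<bar>u (t, x) - (\<Sum>j=1..P. N j t * eigenfunction j x)\<bar> < \<delta>"
    using modal_sum_network[OF \<sigma> u(1) \<open>\<delta> > 0\<close>, of T] by blast
  define N' where "N' j = (if j \<le> P then N j else (\<lambda>t. 0))" for j
  have N'_net: "N' j \<in> networks \<sigma>" for j using N(1) networks_zero by (simp add: N'_def)
  define P' where "P' = max 1 P"
  define G where "G = (\<lambda>(t, x :: real ^ 'n::{finite,linorder}). \<Sum>j=1..P'. N' j t * eigenfunction j x)"
  have G_eq: "G (t, x) = (\<Sum>j=1..P. N j t * eigenfunction j x)" for t x
    unfolding G_def by (simp, rule sum.mono_neutral_cong_right) (auto simp: P'_def N'_def)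
  have "continuous_on UNIV G"
    unfolding G_def eigenfunction_def split_beta
    by (intro continuous_intros continuous_on_compose2[OF networks_continuous[OF \<sigma>(1) N'_net]]) auto
  then have Gm [measurable]: "G \<in> borel_measurable ?M" by (rule continuous_measurable_on_cylinder)
  have um [measurable]: "u \<in> borel_measurable ?M"
    by (rule continuous_measurable_on_cylinder[OF modal_sum_continuous[OF u(1)]])
  have uG: "\<bar>u p - G p\<bar> \<le> \<delta>" if "p \<in> cylinder T" for p
  proof -
    obtain t x where p: "p = (t, x)" by (cases p)
    have "\<bar>t\<bar> \<le> T" using that by (auto simp: p cylinder_def)
    then show ?thesis unfolding p G_eq using N(2)[of t x] by simp
  qed
  have b1: "(\<lambda>p. u p - G p) \<in> L2_space (cylinder T)"
    by (rule L2_spaceI_bounded(1)[OF finite_measure_axioms _ uG]) measurable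
  have "integral\<^sup>L ?M (\<lambda>p. (u p - G p)\<^sup>2) \<le> \<delta>\<^sup>2 * \<mu>"
    unfolding \<mu>_def by (rule L2_spaceI_bounded(2)[OF finite_measure_axioms _ uG]) measurable
  also have "\<dots> = \<epsilon> / 4 / (\<mu> + 1) * \<mu>" using \<open>\<epsilon> > 0\<close> \<open>\<mu> \<ge> 0\<close> by (simp add: \<delta>_def)
  also have "\<dots> \<le> \<epsilon> / 4" using \<open>\<epsilon> > 0\<close> \<open>\<mu> \<ge> 0\<close> by (simp add: field_simps)
  finally have b2: "integral\<^sup>L ?M (\<lambda>p. (u p - G p)\<^sup>2) \<le> \<epsilon> / 4" .
  note tri = L2_diff_triangle[OF u(2) b1]
  have G_close: "(\<lambda>p. F p - G p) \<in> L2_space (cylinder T)" "integral\<^sup>L ?M (\<lambda>p. (F p - G p)\<^sup>2) < \<epsilon>"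
    using tri u(3) b2 by auto
  obtain m A W B where m: "m \<ge> 1"
    and W: "\<And>j. j \<in> {1..P'} \<Longrightarrow> N' j = (\<lambda>t. \<Sum>i<(m::nat). A j i * \<sigma> (W j i * t + B j i))"
    using common_width[of N' \<sigma> P', OF N'_net] by blast
  have "G = (\<lambda>(t, x). \<Sum>j=1..P'. (\<Sum>i<m. A j i * \<sigma> (W j i * t + B j i)) * eigenfunction j x)"
    unfolding G_def by (intro ext) (auto simp: W intro!: sum.cong)
  moreover have "P' \<ge> 1" by (simp add: P'_def)
  ultimately show ?thesis using that G_close m by blast
qed

section \<open>The energy norm of pure velocity fields\<close>

text \<open>
  Iterated integrals require measurability with respect to the product \<open>\<sigma>\<close>-algebra, which Lebesgue
  measurable functions need not have. Functions are therefore extended by zero and replaced by Borel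
  functions that agree with them almost everywhere; the following lemmas transfer measurability and
  integrals back.
\<close>

lemma borel_representative:
  fixes h :: "'a::euclidean_space \<Rightarrow> real"
  assumes "h \<in> borel_measurable (lebesgue_on S)" "S \<in> sets lebesgue"
  obtains k where "k \<in> borel_measurable borel" "AE x in lborel. (if x \<in> S then h x else 0) = k x"
proof -
  have "(\<lambda>x. if x \<in> S then h x else 0) \<in> borel_measurable (completion lborel)"
    using borel_measurable_if_I[OF assms] by simp
  from completion_ex_borel_measurable_real[OF this] show ?thesis using that by auto
qed

lemma
  fixes h k :: "'a::euclidean_space \<Rightarrow> real"
  assumes S: "S \<in> sets lebesgue" and k: "k \<in> borel_measurable borel"
    and eq: "AE x in lborel. (if x \<in> S then h x else 0) = k x"
  shows borel_representative_measurable: "h \<in> borel_measurable (lebesgue_on S)"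
    and borel_representative_integrable: "integrable (lebesgue_on S) h \<longleftrightarrow> integrable lborel k"
    and borel_representative_integral: "integral\<^sup>L (lebesgue_on S) h = integral\<^sup>L lborel k"
proof -
  have k': "k \<in> borel_measurable lborel" using k by simp
  have kl: "k \<in> borel_measurable lebesgue" using k' by (rule measurable_completion)
  have eq': "AE x in lebesgue. (if x \<in> S then h x else 0) = k x" using eq by (rule AE_completion)
  have hl: "(\<lambda>x. if x \<in> S then h x else 0) \<in> borel_measurable lebesgue"
    by (rule borel_measurable_AE[OF kl]) (use eq' in eventually_elim, simp)
  then show "h \<in> borel_measurable (lebesgue_on S)" by (rule borel_measurable_if_D)
  have "integrable (lebesgue_on S) h \<longleftrightarrow> integrable lebesgue (\<lambda>x. if x \<in> S then h x else 0)"
    using Lebesgue_Measure.integrable_restrict_UNIV[OF S, of h] by simp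
  also have "\<dots> \<longleftrightarrow> integrable lebesgue k" by (rule integrable_cong_AE[OF hl kl eq'])
  also have "\<dots> \<longleftrightarrow> integrable lborel k" by (rule integrable_completion[OF k'])
  finally show "integrable (lebesgue_on S) h \<longleftrightarrow> integrable lborel k" .
  have "integral\<^sup>L (lebesgue_on S) h = integral\<^sup>L lebesgue (\<lambda>x. if x \<in> S then h x else 0)"
    using S by (subst integral_restrict_space) (auto intro!: Bochner_Integration.integral_cong simp: indicator_def)
  also have "\<dots> = integral\<^sup>L lebesgue k" by (rule integral_cong_AE[OF hl kl eq'])
  also have "\<dots> = integral\<^sup>L lborel k" by (rule integral_completion[OF k'])
  finally show "integral\<^sup>L (lebesgue_on S) h = integral\<^sup>L lborel k" .
qed

lemma energy_norm_sq_velocity: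
  "(energy_norm \<alpha> ((\<lambda>x. 0), z))\<^sup>2 = integral\<^sup>L (lebesgue_on unit_cube) (\<lambda>x. (z x)\<^sup>2)"
  for z :: "real ^ 'n::finite \<Rightarrow> real"
proof -
  have "integral\<^sup>L (lebesgue_on unit_cube)
      (\<lambda>x :: real ^ 'n. (norm (weak_grad unit_cube (\<lambda>x. 0) x))\<^sup>2 + \<alpha> * 0\<^sup>2) = 0"
    by (rule integral_eq_zero_AE) (use weak_grad_zero in eventually_elim, simp)
  then show ?thesis by (simp add: energy_norm_def)
qed

lemma energy_inner_velocity:
  "energy_inner \<alpha> ((\<lambda>x. 0), z) \<Psi> = integral\<^sup>L (lebesgue_on unit_cube) (\<lambda>x. z x * snd \<Psi> x)"
  for z :: "real ^ 'n::finite \<Rightarrow> real"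
proof -
  have "integral\<^sup>L (lebesgue_on unit_cube) (\<lambda>x :: real ^ 'n.
      weak_grad unit_cube (\<lambda>x. 0) x \<bullet> weak_grad unit_cube (fst \<Psi>) x + \<alpha> * (0 * fst \<Psi> x)) = 0"
    by (rule integral_eq_zero_AE) (use weak_grad_zero in eventually_elim, simp)
  then show ?thesis by (simp add: energy_inner_def)
qed

text \<open>
  Fubini's theorem for the square of a Borel representative \<open>D\<close> of \<open>E\<close>. For almost every \<open>t\<close> the slice
  \<open>D(t, \<cdot>)\<close> is square integrable and represents \<open>E(t, \<cdot>)\<close>; this gives membership in the
  energy space and the norm. Weak measurability holds because \<open>\<integral> D(t, x) \<psi>(x) dx\<close> is a Borel
  function of \<open>t\<close>.
\<close>

lemma L2_energy_velocity:
  fixes E :: "real \<times> (real ^ 'n::finite) \<Rightarrow> real"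
  assumes E: "E \<in> L2_space (cylinder T)"
  shows "(\<lambda>t. ((\<lambda>x. 0), (\<lambda>x. E (t, x)))) \<in> L2_energy \<alpha> {0<..<T}"
    and "L2_energy_norm \<alpha> {0<..<T} (\<lambda>t. ((\<lambda>x. 0), (\<lambda>x. E (t, x))))
      = sqrt (integral\<^sup>L (lebesgue_on (cylinder T)) (\<lambda>p. (E p)\<^sup>2))"
proof -
  let ?J = "{0<..<T}" and ?Q = "unit_cube :: (real ^ 'n) set"
  have Em: "E \<in> borel_measurable (lebesgue_on (cylinder T))"
    and E2: "integrable (lebesgue_on (cylinder T)) (\<lambda>p. (E p)\<^sup>2)"
    using E by (auto simp: L2_space_def)
  obtain D where D: "D \<in> borel_measurable borel"
    "AE p in lborel. (if p \<in> cylinder T then E p else 0) = D p"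
    using borel_representative[OF Em cylinder_lebesgue] .
  have J: "?J \<in> sets lebesgue" by simp
  have Dm [measurable]: "D \<in> borel_measurable (lborel \<Otimes>\<^sub>M lborel)" using D(1) by (simp add: lborel_prod)
  have D2m: "(\<lambda>p. (D p)\<^sup>2) \<in> borel_measurable borel" using D(1) by measurable
  have D2: "AE p in lborel. (if p \<in> cylinder T then (E p)\<^sup>2 else 0) = (D p)\<^sup>2"
    using D(2) by eventually_elim (auto split: if_splits)
  have D_int: "integrable (lborel \<Otimes>\<^sub>M lborel) (\<lambda>p. (D p)\<^sup>2)"
    using E2 borel_representative_integrable[OF cylinder_lebesgue D2m D2] by (simp add: lborel_prod)
  have norm_eq: "integral\<^sup>L (lebesgue_on (cylinder T)) (\<lambda>p. (E p)\<^sup>2) = integral\<^sup>L (lborel \<Otimes>\<^sub>M lborel) (\<lambda>p. (D p)\<^sup>2)"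
    using borel_representative_integral[OF cylinder_lebesgue D2m D2] by (simp add: lborel_prod)

  \<comment> \<open>the times whose slices behave well; almost all of them, by Fubini\<close>
  define good where "good t \<longleftrightarrow> (AE x in lborel. (if (t, x) \<in> cylinder T then E (t, x) else 0) = D (t, x))
    \<and> integrable lborel (\<lambda>x. (D (t, x))\<^sup>2)" for t
  have "AE p in lborel \<Otimes>\<^sub>M lborel. (if p \<in> cylinder T then E p else 0) = D p"
    unfolding lborel_prod by (rule D(2))
  from lborel_pair.AE_pair[OF this] lborel_pair.AE_integrable_fst'[OF D_int]
  have good: "AE t in lborel. good t" by eventually_elim (simp add: good_def)
  have slice_meas: "(\<lambda>x. D (t, x)) \<in> borel_measurable borel" for t
  proof -
    have "(\<lambda>x. D (t, x)) \<in> borel_measurable lborel" by measurable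
    then show ?thesis by simp
  qed
  have slice: "AE x in lborel. (if x \<in> ?Q then E (t, x) else 0) = D (t, x)" if "good t" "t \<in> ?J" for t
    using that by (simp add: good_def cylinder_def)
  have off: "AE x in lborel. D (t, x) = 0" if "good t" "t \<notin> ?J" for t
    using that by (auto simp: good_def cylinder_def elim: eventually_mono)
  have slice_sq: "AE x in lborel. (if x \<in> ?Q then (E (t, x))\<^sup>2 else 0) = (D (t, x))\<^sup>2"
    if "good t" "t \<in> ?J" for t
    using slice[OF that] by eventually_elim (auto split: if_splits)
  have slice_sq_m: "(\<lambda>x. (D (t, x))\<^sup>2) \<in> borel_measurable borel" for t
    using slice_meas[of t] by measurable

  have norm_slice: "AE t in lborel. (if t \<in> ?J then (energy_norm \<alpha> ((\<lambda>x. 0), (\<lambda>x. E (t, x))))\<^sup>2 else 0)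
      = integral\<^sup>L lborel (\<lambda>x. (D (t, x))\<^sup>2)"
    using good
  proof eventually_elim
    case (elim t)
    show ?case
    proof (cases "t \<in> ?J")
      case True
      then show ?thesis
        using borel_representative_integral[OF unit_cube_lebesgue slice_sq_m slice_sq[OF elim True]]
        by (simp only: energy_norm_sq_velocity if_True)
    next
      case False
      have "integral\<^sup>L lborel (\<lambda>x. (D (t, x))\<^sup>2) = 0"
        by (rule integral_eq_zero_AE) (use off[OF elim False] in eventually_elim, simp)
      then show ?thesis using False by (simp only: if_False)
    qed
  qed
  have slice_int: "integrable lborel (\<lambda>t. integral\<^sup>L lborel (\<lambda>x. (D (t, x))\<^sup>2))"
    by (rule lborel_pair.integrable_fst'[OF D_int])
  then have slice_m: "(\<lambda>t. integral\<^sup>L lborel (\<lambda>x. (D (t, x))\<^sup>2)) \<in> borel_measurable borel" by auto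

  have "AE t in lebesgue_on ?J. ((\<lambda>x. 0), (\<lambda>x. E (t, x))) \<in> energy_space"
  proof -
    have "AE t in lebesgue. good t" using good by (rule AE_completion)
    then have "AE t in lebesgue_on ?J. good t \<and> t \<in> ?J"
      by (subst AE_restrict_space_iff) (auto elim: eventually_mono)
    then show ?thesis
    proof eventually_elim
      case (elim t)
      then have "(\<lambda>x. E (t, x)) \<in> borel_measurable (lebesgue_on ?Q)"
        by (intro borel_representative_measurable[OF unit_cube_lebesgue slice_meas slice]) auto
      moreover have "integrable (lebesgue_on ?Q) (\<lambda>x. (E (t, x))\<^sup>2)"
        using elim borel_representative_integrable[OF unit_cube_lebesgue slice_sq_m slice_sq]
        by (simp add: good_def)
      ultimately show ?case by (simp add: energy_space_def L2_space_def zero_H1_0)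
    qed
  qed
  moreover have "(\<lambda>t. energy_inner \<alpha> ((\<lambda>x. 0), (\<lambda>x. E (t, x))) \<Psi>) \<in> borel_measurable (lebesgue_on ?J)"
    if "\<Psi> \<in> energy_space" for \<Psi> :: "'n state"
  proof -
    have "snd \<Psi> \<in> borel_measurable (lebesgue_on ?Q)"
      using that by (auto simp: energy_space_def L2_space_def)
    then obtain \<psi> where \<psi>: "\<psi> \<in> borel_measurable borel"
      "AE x in lborel. (if x \<in> ?Q then snd \<Psi> x else 0) = \<psi> x"
      using borel_representative unit_cube_lebesgue by blast
    have \<psi>m [measurable]: "\<psi> \<in> borel_measurable lborel" using \<psi>(1) by simp
    let ?k = "\<lambda>t. integral\<^sup>L lborel (\<lambda>x. D (t, x) * \<psi> x)"
    show ?thesis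
    proof (rule borel_representative_measurable[OF J])
      have "?k \<in> borel_measurable lborel" by measurable
      then show "?k \<in> borel_measurable borel" by simp
      show "AE t in lborel. (if t \<in> ?J then energy_inner \<alpha> ((\<lambda>x. 0), (\<lambda>x. E (t, x))) \<Psi> else 0) = ?k t"
        using good
      proof eventually_elim
        case (elim t)
        show ?case
        proof (cases "t \<in> ?J")
          case True
          have m: "(\<lambda>x. D (t, x) * \<psi> x) \<in> borel_measurable borel"
            using slice_meas[of t] \<psi>(1) by measurable
          have "AE x in lborel. (if x \<in> ?Q then E (t, x) * snd \<Psi> x else 0) = D (t, x) * \<psi> x"
            using slice[OF elim True] \<psi>(2) by eventually_elim (auto split: if_splits)
          from borel_representative_integral[OF unit_cube_lebesgue m this] show ?thesis
            using True by (simp only: energy_inner_velocity if_True)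
        next
          case False
          have "?k t = 0"
            by (rule integral_eq_zero_AE) (use off[OF elim False] in eventually_elim, simp)
          then show ?thesis using False by (simp only: if_False)
        qed
      qed
    qed
  qed
  moreover have "integrable (lebesgue_on ?J) (\<lambda>t. (energy_norm \<alpha> ((\<lambda>x. 0), (\<lambda>x. E (t, x))))\<^sup>2)"
    using slice_int borel_representative_integrable[OF J slice_m norm_slice] by blast
  ultimately show "(\<lambda>t. ((\<lambda>x. 0), (\<lambda>x. E (t, x)))) \<in> L2_energy \<alpha> ?J"
    by (simp add: L2_energy_def energy_measurable_def)
  show "L2_energy_norm \<alpha> ?J (\<lambda>t. ((\<lambda>x. 0), (\<lambda>x. E (t, x))))
      = sqrt (integral\<^sup>L (lebesgue_on (cylinder T)) (\<lambda>p. (E p)\<^sup>2))"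
    unfolding L2_energy_norm_def borel_representative_integral[OF J slice_m norm_slice] norm_eq
      lborel_pair.integral_fst'[OF D_int] ..
qed

section \<open>Approximation of the control\<close>

lemma L2_space_extend_zero:
  fixes f :: "'a::euclidean_space \<Rightarrow> real"
  assumes f: "f \<in> L2_space S" and S: "S \<in> sets lebesgue" and U: "U \<in> sets lebesgue" and sub: "S \<subseteq> U"
  shows "(\<lambda>x. if x \<in> S then f x else 0) \<in> L2_space U"
proof -
  have "(\<lambda>x. if x \<in> S then f x else 0) \<in> borel_measurable (lebesgue_on U)"
    using f by (simp add: borel_measurable_if_lebesgue_on[OF S U sub] L2_space_def)
  moreover have "integrable (lebesgue_on U) (\<lambda>x. (if x \<in> S then f x else 0)\<^sup>2)"
  proof -
    have "integrable lebesgue (\<lambda>x. if x \<in> S then (f x)\<^sup>2 else 0)"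
      using f by (simp add: Lebesgue_Measure.integrable_restrict_UNIV[OF S] L2_space_def)
    moreover have "(\<lambda>x. if x \<in> S then (f x)\<^sup>2 else 0) = (\<lambda>x. if x \<in> U then (if x \<in> S then f x else 0)\<^sup>2 else 0)"
      using sub by (intro ext) auto
    ultimately have "integrable lebesgue (\<lambda>x. if x \<in> U then (if x \<in> S then f x else 0)\<^sup>2 else 0)" by simp
    then show ?thesis by (simp only: Lebesgue_Measure.integrable_restrict_UNIV[OF U])
  qed
  ultimately show ?thesis by (simp add: L2_space_def)
qed

lemma L2_space_cong:
  "(\<And>x. x \<in> S \<Longrightarrow> f x = h x) \<Longrightarrow> f \<in> L2_space S \<longleftrightarrow> h \<in> L2_space S"
  unfolding L2_space_def
  using measurable_cong[of "lebesgue_on S" f h borel]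
    Bochner_Integration.integrable_cong[of "lebesgue_on S" "lebesgue_on S" "\<lambda>x. (f x)\<^sup>2" "\<lambda>x. (h x)\<^sup>2"]
  by simp

lemma L2_space_indicator_mult:
  assumes h: "h \<in> L2_space U" and S: "S \<in> sets lebesgue"
  shows "(\<lambda>x. indicator S x * h x) \<in> L2_space U"
proof -
  have [measurable]: "h \<in> borel_measurable (lebesgue_on U)" using h by (simp add: L2_space_def)
  have [measurable]: "(indicator S :: _ \<Rightarrow> real) \<in> borel_measurable (lebesgue_on U)"
    by (intro measurable_restrict_space1 borel_measurable_indicator S)
  have "integrable (lebesgue_on U) (\<lambda>x. (indicator S x * h x)\<^sup>2)"
  proof (rule Bochner_Integration.integrable_bound)
    show "integrable (lebesgue_on U) (\<lambda>x. (h x)\<^sup>2)" using h by (simp add: L2_space_def)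
    show "(\<lambda>x. (indicator S x * h x)\<^sup>2) \<in> borel_measurable (lebesgue_on U)" by measurable
    show "AE x in lebesgue_on U. norm ((indicator S x * h x)\<^sup>2) \<le> norm ((h x)\<^sup>2)"
      by (intro AE_I2) (auto simp: indicator_def)
  qed
  then show ?thesis unfolding L2_space_def by simp
qed

text \<open>
  The control is extended by zero from \<open>(0,T) \<times> \<omega>\<close> to the cylinder and approximated there.
  Restricting the difference to \<open>\<omega>\<close> does not increase its norm.
\<close>

theorem theorem10:
  fixes \<omega> :: "(real ^ 'n::{finite,linorder}) set"
    and T \<alpha> \<epsilon> :: real
    and g \<sigma> :: "real \<Rightarrow> real"
    and f :: "real \<times> (real ^ 'n::{finite,linorder}) \<Rightarrow> real"
    and \<Phi>0 \<Phi>T :: "'n state"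
  assumes "open \<omega>" and "\<omega> \<noteq> {}" and "\<omega> \<subseteq> unit_cube"
    and "T > 0" and "\<alpha> \<ge> 0"
    and "geometric_control_condition \<omega> T"
    and "\<And>u :: real ^ 'n::{finite,linorder} \<Rightarrow> real. u \<in> H1_0 unit_cube \<Longrightarrow> (\<lambda>x. g (u x)) \<in> L2_space unit_cube"
    and "\<Phi>0 \<in> energy_space" and "\<Phi>T \<in> energy_space"
    and "f \<in> L2_space ({0<..<T} \<times> \<omega>)"
    and "steers \<alpha> g (localized \<omega> f) T \<Phi>0 \<Phi>T"
    and "\<epsilon> > 0"
    and "C_k 2 \<sigma>" and "\<nexists>p :: real poly. \<sigma> = poly p"
  shows "\<exists>P\<ge>1. \<exists>m\<ge>1. \<exists>A W B :: nat \<Rightarrow> nat \<Rightarrow> real.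
    let f_net = (\<lambda>(t, x). \<Sum>j=1..P. (\<Sum>i<m. A j i * \<sigma> (W j i * t + B j i)) * eigenfunction j x);
        err = (\<lambda>t. localized \<omega> f_net t - localized \<omega> f t)
    in err \<in> L2_energy \<alpha> {0<..<T} \<and> L2_energy_norm \<alpha> {0<..<T} err < \<epsilon>"
proof -
  let ?C = "cylinder T :: (real \<times> (real ^ 'n::{finite,linorder})) set"
  let ?S = "{0<..<T} \<times> \<omega>"
  define F where "F p = (if p \<in> ?S then f p else 0)" for p
  have \<sigma>: "continuous_on UNIV \<sigma>" by (rule C_k_imp_continuous[OF \<open>C_k 2 \<sigma>\<close>])
  have "open ?S" using \<open>open \<omega>\<close> by (intro open_Times) auto
  then have S: "?S \<in> sets lebesgue" by (intro sets_completionI_sets) simp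
  have SC: "?S \<subseteq> ?C" using \<open>\<omega> \<subseteq> unit_cube\<close> by (auto simp: cylinder_def)
  have F: "F \<in> L2_space ?C"
    unfolding F_def[abs_def] by (rule L2_space_extend_zero[OF \<open>f \<in> L2_space ?S\<close> S cylinder_lebesgue SC])
  have "\<epsilon>\<^sup>2 > 0" using \<open>\<epsilon> > 0\<close> by simp
  obtain P m :: nat and A W B :: "nat \<Rightarrow> nat \<Rightarrow> real" and G where Pm: "P \<ge> 1" "m \<ge> 1"
    and G: "G = (\<lambda>(t, x). \<Sum>j=1..P. (\<Sum>i<m. A j i * \<sigma> (W j i * t + B j i)) * eigenfunction j x)"
    and FG: "(\<lambda>p. F p - G p) \<in> L2_space ?C" "integral\<^sup>L (lebesgue_on ?C) (\<lambda>p. (F p - G p)\<^sup>2) < \<epsilon>\<^sup>2"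
    by (rule eigenfunction_network_dense[OF \<sigma> \<open>\<nexists>p. \<sigma> = poly p\<close> F \<open>\<epsilon>\<^sup>2 > 0\<close>])
  \<comment> \<open>the second component of the error at time \<open>t\<close> is \<open>E (t, \<cdot>)\<close>\<close>
  define E where "E p = G p * indicator \<omega> (snd p) - f p * indicator \<omega> (snd p)" for p
  have E_eq: "E p = - (indicator ?S p * (F p - G p))" if "p \<in> ?C" for p
    using that by (auto simp: E_def F_def cylinder_def indicator_def)
  have "(\<lambda>p. indicator ?S p * (F p - G p)) \<in> L2_space ?C"
    by (rule L2_space_indicator_mult[OF FG(1) S])
  then have E: "E \<in> L2_space ?C"
    by (subst L2_space_cong[OF E_eq]) (simp_all add: L2_space_def)
  have "integral\<^sup>L (lebesgue_on ?C) (\<lambda>p. (E p)\<^sup>2) \<le> integral\<^sup>L (lebesgue_on ?C) (\<lambda>p. (F p - G p)\<^sup>2)"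
    using E FG(1) by (intro integral_mono) (auto simp: L2_space_def E_eq indicator_def)
  then have small: "sqrt (integral\<^sup>L (lebesgue_on ?C) (\<lambda>p. (E p)\<^sup>2)) < \<epsilon>"
    using FG(2) \<open>\<epsilon> > 0\<close> by (intro real_less_lsqrt) auto
  have err: "(\<lambda>t. localized \<omega> G t - localized \<omega> f t) = (\<lambda>t. ((\<lambda>x. 0), (\<lambda>x. E (t, x))))"
    by (simp add: localized_def E_def fun_eq_iff)
  have "(\<lambda>t. localized \<omega> G t - localized \<omega> f t) \<in> L2_energy \<alpha> {0<..<T}"
    "L2_energy_norm \<alpha> {0<..<T} (\<lambda>t. localized \<omega> G t - localized \<omega> f t) < \<epsilon>"
    unfolding err using L2_energy_velocity[OF E] small by auto
  then show ?thesis
    using Pm unfolding G Let_def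
    by (intro exI[of _ P] exI[of _ m] exI[of _ A] exI[of _ W] exI[of _ B] conjI)
qed

end
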